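(* Let $(\hat\Omega,\mathcal A,\mu)$ be a $\sigma$-finite measure space, $\Omega\subseteq\hat\Omega$ measurable. Assume that $\Phi:\hat\Omega\times\hat\Omega\times\mathbb R\to[0,\infty]$ satisfies the standard conditions and is continuously partially differentiable in the third variable with derivative $\varphi$ (condition (D) of the context). Let $\mathcal E(\hat u)=\frac12\int_{\hat\Omega}\int_{\hat\Omega}\Phi(x,y,\hat u(x)-\hat u(y))\,d\mu(y)d\mu(x)$ on $W^{\Phi,2}(\hat\Omega,\Omega)$, let $j$ be the restriction operator $j(\hat u)=\hat u|_\Omega$ into $L^2(\Omega)$, let $\partial_j\mathcal E$ be the $j$-subgradient on $L^2(\Omega)$, and let $u,f\in L^2(\Omega)$. Let $\mathcal D\subseteq W^{\Phi,2}(\hat\Omega,\Omega)$ be a linear subspace which separates the points of its associate space $\mathcal D_a$. Then $(u,f)\in\partial_j\mathcal E$ if and only if there exists $\hat u\in W^{\Phi,2}(\hat\Omega,\Omega)$ such that $\hat u|_\Omega=u$, $\hat u$ is a weak solution of $$P.V.\!\int_{\hat\Omega}\varphi(x,y,\hat u(x)-\hat u(y))\,d\mu(y)=f(x)\ \text{ in }\Omega,\qquad P.V.\!\int_{\hat\Omega}\varphi(x,y,\hat u(x)-\hat u(y))\,d\mu(y)=0\ \text{ in }\hat\Omega\setminus\Omega,$$ and moreover, for every $\hat v\in W^{\Phi,2}(\hat\Omega,\Omega)$, $$\tfrac12\int_{\hat\Omega}\int_{\hat\Omega}\varphi(x,y,\hat u(x)-\hat u(y))(\hat v(x)-\hat v(y))\,d\mu(y)d\mu(x)=\int_{\hat\Omega}\Big(P.V.\!\int_{\hat\Omega}\varphi(x,y,\hat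 u(x)-\hat u(y))\,d\mu(y)\Big)\hat v(x)\,d\mu(x).$$ Every such $\hat u$ is an elliptic extension of $u$ and satisfies $\hat u=\operatorname{arg\,min}_{j(\hat w)=u}(\mathcal E(\hat w)-\int_\Omega f\hat w\,d\mu)=\operatorname{arg\,min}_{j(\hat w)=u}\mathcal E(\hat w)$. The elliptic extension is unique when $\Phi(x,y,\cdot)$ is strictly convex for every $(x,y)\in\mathbf S_\Phi$.
   Context: $L^0(X)$ denotes real measurable functions on $X$ modulo a.e. equality. Condition (C) on $\Phi$: $\Phi(\cdot,\cdot,s)$ is measurable for every $s$; and for all $x,y$: $\Phi(x,y,0)=0$, $\Phi(x,y,\cdot)$ is lower semicontinuous, convex and even, and $\Phi(x,y,\cdot)=\Phi(y,x,\cdot)$. Fenchel conjugate: $\Phi^*(x,y,t)=\sup_{s}(st-\Phi(x,y,s))$. $\Delta_2$-condition: there are $K>0$ and an integrable $h:\hat\Omega\times\hat\Omega\to[0,\infty)$ with $\Phi(x,y,2s)\le K\Phi(x,y,s)+h(x,y)$ for all $x,y,s$. $\mathbf S_\Phi=(\hat\Omega\times\hat\Omega)\setminus\{(x,y):\Phi(x,y,s)=0\ \forall s\}$. Thickness condition on $\mathbf S_\Phi$: there exist a sequence $(A^{(0)}_n)_{n\in\mathbb N}$ of measurable subsets of $\Omega$ and a set $\hat N\subseteq\hat\Omega$ of measure zero such that, when we define and choose recursively for $m\ge0$: $I^{(m)}:=\{n\in\mathbb N:\mu(A^{(m)}_n)>0\}$; $(B^{(m+1)}_n)_{n\in\mathbb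 N}$ any sequence of measurable sets such that $A^{(m)}_n\times B^{(m+1)}_n\subseteq\mathbf S_\Phi$ for every $n\in\mathbb N$; $(A^{(m+1)}_n)_{n\in\mathbb N}$ any sequence of measurable sets such that $\bigcup_nA^{(m+1)}_n=\bigcup_nB^{(m+1)}_n$; then $\hat\Omega\setminus\hat N=\bigcup_{m\in\mathbb N}\bigcup_{n\in I^{(m)}}A^{(m)}_n$. Standard conditions: $\Phi$ satisfies (C), $\Phi$ and $\Phi^*$ satisfy the $\Delta_2$-condition, $\mathbf S_\Phi$ satisfies the thickness condition. Condition (D): there is $\varphi:\hat\Omega\times\hat\Omega\times\mathbb R\to\mathbb R$ such that $\varphi(\cdot,\cdot,s)$ is measurable and symmetric for every $s$, $\varphi(x,y,0)=0$, $\varphi(x,y,\cdot)$ is continuous, increasing and odd, and $\Phi(x,y,s)=\int_0^s\varphi(x,y,\tau)\,d\tau$ for all $x,y,s$. $W^{\Phi,0}(\hat\Omega)=\{\hat u\in L^0(\hat\Omega):\exists\lambda>0,\ \int\int\Phi(x,y,(\hat u(x)-\hat u(y))/\lambda)\,d\mu d\mu<\infty\}$ with seminorm $\|\hat u\|_{W^{\Phi,0}}=\inf\{\lambda>0:\int\int\Phi(x,y,(\hat u(x)-\hat u(y))/\lambda)\,d\mu d\mu\le1\}$; $W^{\Phi,2}(\hat\Omega,\Omega)=\{\hat u\in W^{\Phi,0}(\hat\Omega):\hat u|_\Omega\in L^2(\Omega)\}$ with norm $\|\hat u|_\Omega\|_{L^2(\Omega)}+\|\hat u\|_{W^{\Phi,0}}$.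 $\partial_j\mathcal E$: set of $(u,f)\in L^2(\Omega)^2$ for which there is $\hat u\in W^{\Phi,2}(\hat\Omega,\Omega)$ with $\mathcal E(\hat u)<\infty$, $j(\hat u)=u$, $\mathcal E(\hat u+\hat v)-\mathcal E(\hat u)\ge\int_\Omega f\,j(\hat v)\,d\mu$ for all $\hat v\in W^{\Phi,2}(\hat\Omega,\Omega)$; such $\hat u$ is an elliptic extension of $u$. $\mathcal D_a=\{\hat g\in L^0(\hat\Omega):\hat g\hat v\in L^1(\hat\Omega)\ \forall\hat v\in\mathcal D\}$; $\mathcal D$ separates the points of $\mathcal D_a$ if for $\hat g\in\mathcal D_a$, $\int_{\hat\Omega}\hat g\hat v\,d\mu=0$ for all $\hat v\in\mathcal D$ implies $\hat g=0$. For $\hat f\in\mathcal D_a$, $\hat u$ is a weak solution of $P.V.\int_{\hat\Omega}\varphi(x,y,\hat u(x)-\hat u(y))\,d\mu(y)=\hat f(x)$ ($x\in\hat\Omega$), i.e. the Cauchy principal value exists in a weak sense and equals $\hat f$, if for every $\hat v\in\mathcal D$: $\frac12\int\int\varphi(x,y,\hat u(x)-\hat u(y))(\hat v(x)-\hat v(y))\,d\mu(y)d\mu(x)=\int_{\hat\Omega}\hat f\hat v\,d\mu$. The two displayed equations are understood as one Cauchy principal value on $\hat\Omega$, i.e. as this single equation with $\hat f=f$ on $\Omega$, $\hat f=0$ on $\hat\Omega\setminus\Omega$; the symbol $P.V.\int$ in the last identity denotes this principal value.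
   Formalization: In the thickness condition the sets are chosen existentially and the union of the B^(m+1)_n runs only over n in I^(m), i.e. those with μ(A^(m)_n)>0; with the union over all n, null sets could make S_Φ thick and uniqueness of the elliptic extension fails. *)

theory Defs
  imports "HOL-Analysis.Analysis"
begin

text \<open>
  The measure space is \<open>M\<close>, with underlying set \<open>space M\<close>. Elements of \<open>L\<^sup>0\<close>, \<open>L\<^sup>2\<close> and of the
  spaces below are represented by measurable functions; equality of classes is equality almost
  everywhere. Functions on a measurable \<open>\<Omega> \<subseteq> space M\<close> are functions on \<open>restrict_space M \<Omega>\<close>, so
  that restricting a function to \<open>\<Omega>\<close> does not change its representative.
\<close>

definition L2 :: "'a measure \<Rightarrow> ('a \<Rightarrow> real) set" where
  "L2 N = {u \<in> borel_measurable N. integrable N (\<lambda>x. (u x)\<^sup>2)}"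

definition lower_semicontinuous :: "(real \<Rightarrow> ennreal) \<Rightarrow> bool" where
  "lower_semicontinuous F \<longleftrightarrow> (\<forall>s. F s \<le> Liminf (at s) F)"

text \<open>
  The library's \<open>convex_on\<close> is for real-valued functions only.
\<close>

definition convex_fun :: "(real \<Rightarrow> ennreal) \<Rightarrow> bool" where
  "convex_fun F \<longleftrightarrow> (\<forall>s r t. 0 \<le> t \<and> t \<le> 1 \<longrightarrow>
     F ((1 - t) * s + t * r) \<le> ennreal (1 - t) * F s + ennreal t * F r)"

definition strictly_convex_fun :: "(real \<Rightarrow> ennreal) \<Rightarrow> bool" where
  "strictly_convex_fun F \<longleftrightarrow> (\<forall>s r t. s \<noteq> r \<and> 0 < t \<and> t < 1 \<longrightarrow>
     F ((1 - t) * s + t * r) < ennreal (1 - t) * F s + ennreal t * F r)"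

definition condition_C :: "'a measure \<Rightarrow> ('a \<Rightarrow> 'a \<Rightarrow> real \<Rightarrow> ennreal) \<Rightarrow> bool" where
  "condition_C M \<Phi> \<longleftrightarrow>
     (\<forall>s. (\<lambda>(x, y). \<Phi> x y s) \<in> borel_measurable (M \<Otimes>\<^sub>M M)) \<and>
     (\<forall>x\<in>space M. \<forall>y\<in>space M.
        \<Phi> x y 0 = 0 \<and> lower_semicontinuous (\<Phi> x y) \<and> convex_fun (\<Phi> x y) \<and>
        (\<forall>s. \<Phi> x y (- s) = \<Phi> x y s) \<and> (\<forall>s. \<Phi> x y s = \<Phi> y x s))"

text \<open>
  Under \<open>condition_C\<close> the supremum is nonnegative (take \<open>s = 0\<close>), so \<open>e2ennreal\<close> loses nothing.
\<close>

definition fenchel_conjugate ::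
    "('a \<Rightarrow> 'a \<Rightarrow> real \<Rightarrow> ennreal) \<Rightarrow> 'a \<Rightarrow> 'a \<Rightarrow> real \<Rightarrow> ennreal" where
  "fenchel_conjugate \<Phi> x y t = e2ennreal (SUP s. ereal (s * t) - enn2ereal (\<Phi> x y s))"

definition delta2_condition :: "'a measure \<Rightarrow> ('a \<Rightarrow> 'a \<Rightarrow> real \<Rightarrow> ennreal) \<Rightarrow> bool" where
  "delta2_condition M \<Phi> \<longleftrightarrow>
     (\<exists>(K::real) (h :: 'a \<times> 'a \<Rightarrow> real). K > 0 \<and> integrable (M \<Otimes>\<^sub>M M) h \<and>
        (\<forall>x\<in>space M. \<forall>y\<in>space M. 0 \<le> h (x, y) \<and>
           (\<forall>s. \<Phi> x y (2 * s) \<le> ennreal K * \<Phi> x y s + ennreal (h (x, y)))))"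

definition S_set :: "'a measure \<Rightarrow> ('a \<Rightarrow> 'a \<Rightarrow> real \<Rightarrow> ennreal) \<Rightarrow> ('a \<times> 'a) set" where
  "S_set M \<Phi> = space M \<times> space M - {(x, y). \<forall>s. \<Phi> x y s = 0}"

text \<open>
  The sets \<open>A (Suc m)\<close> and \<open>B (Suc m)\<close> are chosen, i.e. existentially quantified. Only the indices
  in \<open>I m\<close> feed the next stage: if a null set \<open>A m n\<close> were allowed to contribute its \<open>B (Suc m) n\<close>,
  then \<open>{p} \<times> space M \<union> space M \<times> {p}\<close>, for \<open>p \<in> \<Omega>\<close> with \<open>{p}\<close> a null set, would count as
  thick although it is itself a null set.
\<close>

definition thick :: "'a measure \<Rightarrow> 'a set \<Rightarrow> ('a \<times> 'a) set \<Rightarrow> bool" where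
  "thick M \<Omega> S \<longleftrightarrow>
     (\<exists>(A :: nat \<Rightarrow> nat \<Rightarrow> 'a set) (B :: nat \<Rightarrow> nat \<Rightarrow> 'a set) (I :: nat \<Rightarrow> nat set) N.
        (\<forall>m n. A m n \<in> sets M) \<and> (\<forall>n. A 0 n \<subseteq> \<Omega>) \<and> N \<in> null_sets M \<and>
        (\<forall>m. I m = {n. emeasure M (A m n) > 0}) \<and>
        (\<forall>m n. B (Suc m) n \<in> sets M \<and> A m n \<times> B (Suc m) n \<subseteq> S) \<and>
        (\<forall>m. (\<Union>n. A (Suc m) n) = (\<Union>n\<in>I m. B (Suc m) n)) \<and>
        space M - N = (\<Union>m. \<Union>n\<in>I m. A m n))"

definition standard_conditions ::
    "'a measure \<Rightarrow> 'a set \<Rightarrow> ('a \<Rightarrow> 'a \<Rightarrow> real \<Rightarrow> ennreal) \<Rightarrow> bool" where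
  "standard_conditions M \<Omega> \<Phi> \<longleftrightarrow>
     condition_C M \<Phi> \<and> delta2_condition M \<Phi> \<and> delta2_condition M (fenchel_conjugate \<Phi>) \<and>
     thick M \<Omega> (S_set M \<Phi>)"

text \<open>
  Increasing is meant in the weak sense: \<open>\<phi> x y\<close> vanishes for \<open>(x, y)\<close> outside \<open>S_set M \<Phi>\<close>. The
  interval integral is oriented, so it is also right for \<open>s < 0\<close>.
\<close>

definition condition_D ::
    "'a measure \<Rightarrow> ('a \<Rightarrow> 'a \<Rightarrow> real \<Rightarrow> ennreal) \<Rightarrow> ('a \<Rightarrow> 'a \<Rightarrow> real \<Rightarrow> real) \<Rightarrow> bool" where
  "condition_D M \<Phi> \<phi> \<longleftrightarrow>
     (\<forall>s. (\<lambda>(x, y). \<phi> x y s) \<in> borel_measurable (M \<Otimes>\<^sub>M M)) \<and>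
     (\<forall>x\<in>space M. \<forall>y\<in>space M.
        (\<forall>s. \<phi> x y s = \<phi> y x s) \<and> \<phi> x y 0 = 0 \<and> continuous_on UNIV (\<phi> x y) \<and>
        mono (\<phi> x y) \<and> (\<forall>s. \<phi> x y (- s) = - \<phi> x y s) \<and>
        (\<forall>s::real. \<Phi> x y s = ennreal (LBINT \<tau>=0..s. \<phi> x y \<tau>)))"

definition W0 :: "'a measure \<Rightarrow> ('a \<Rightarrow> 'a \<Rightarrow> real \<Rightarrow> ennreal) \<Rightarrow> ('a \<Rightarrow> real) set" where
  "W0 M \<Phi> = {u \<in> borel_measurable M.
     \<exists>c>0. (\<integral>\<^sup>+ x. (\<integral>\<^sup>+ y. \<Phi> x y ((u x - u y) / c) \<partial>M) \<partial>M) < \<infinity>}"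

definition W2 ::
    "'a measure \<Rightarrow> 'a set \<Rightarrow> ('a \<Rightarrow> 'a \<Rightarrow> real \<Rightarrow> ennreal) \<Rightarrow> ('a \<Rightarrow> real) set" where
  "W2 M \<Omega> \<Phi> = {u \<in> W0 M \<Phi>. u \<in> L2 (restrict_space M \<Omega>)}"

definition energy ::
    "'a measure \<Rightarrow> ('a \<Rightarrow> 'a \<Rightarrow> real \<Rightarrow> ennreal) \<Rightarrow> ('a \<Rightarrow> real) \<Rightarrow> ennreal" where
  "energy M \<Phi> u = (\<integral>\<^sup>+ x. (\<integral>\<^sup>+ y. \<Phi> x y (u x - u y) \<partial>M) \<partial>M) / 2"

text \<open>
  \<open>restricts_to M \<Omega> uh u\<close> is \<open>j(uh) = u\<close> in \<open>L\<^sup>2(\<Omega>)\<close>, where \<open>j\<close> is the restriction operator.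
\<close>

definition restricts_to :: "'a measure \<Rightarrow> 'a set \<Rightarrow> ('a \<Rightarrow> real) \<Rightarrow> ('a \<Rightarrow> real) \<Rightarrow> bool" where
  "restricts_to M \<Omega> uh u \<longleftrightarrow> (AE x in restrict_space M \<Omega>. uh x = u x)"

text \<open>
  \<open>uh\<close> is an elliptic extension of \<open>u\<close>, witnessing that \<open>(u, f)\<close> is in the \<open>j\<close>-subgradient.
\<close>

definition elliptic_extension ::
    "'a measure \<Rightarrow> 'a set \<Rightarrow> ('a \<Rightarrow> 'a \<Rightarrow> real \<Rightarrow> ennreal) \<Rightarrow>
     ('a \<Rightarrow> real) \<Rightarrow> ('a \<Rightarrow> real) \<Rightarrow> ('a \<Rightarrow> real) \<Rightarrow> bool" where
  "elliptic_extension M \<Omega> \<Phi> u f uh \<longleftrightarrow>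
     u \<in> L2 (restrict_space M \<Omega>) \<and> f \<in> L2 (restrict_space M \<Omega>) \<and>
     uh \<in> W2 M \<Omega> \<Phi> \<and> energy M \<Phi> uh < \<infinity> \<and> restricts_to M \<Omega> uh u \<and>
     (\<forall>vh\<in>W2 M \<Omega> \<Phi>.
        enn2ereal (energy M \<Phi> (\<lambda>x. uh x + vh x)) - enn2ereal (energy M \<Phi> uh)
          \<ge> ereal (LINT x:\<Omega>|M. f x * vh x))"

definition j_subgradient ::
    "'a measure \<Rightarrow> 'a set \<Rightarrow> ('a \<Rightarrow> 'a \<Rightarrow> real \<Rightarrow> ennreal) \<Rightarrow> (('a \<Rightarrow> real) \<times> ('a \<Rightarrow> real)) set" where
  "j_subgradient M \<Omega> \<Phi> = {(u, f). \<exists>uh. elliptic_extension M \<Omega> \<Phi> u f uh}"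

definition linear_subspace :: "('a \<Rightarrow> real) set \<Rightarrow> bool" where
  "linear_subspace D \<longleftrightarrow> (\<lambda>x. 0) \<in> D \<and>
     (\<forall>v\<in>D. \<forall>w\<in>D. (\<lambda>x. v x + w x) \<in> D) \<and> (\<forall>c. \<forall>v\<in>D. (\<lambda>x. c * v x) \<in> D)"

definition associate_space :: "'a measure \<Rightarrow> ('a \<Rightarrow> real) set \<Rightarrow> ('a \<Rightarrow> real) set" where
  "associate_space M D = {g \<in> borel_measurable M. \<forall>v\<in>D. integrable M (\<lambda>x. g x * v x)}"

definition separates_points_of_associate :: "'a measure \<Rightarrow> ('a \<Rightarrow> real) set \<Rightarrow> bool" where
  "separates_points_of_associate M D \<longleftrightarrow>
     (\<forall>g\<in>associate_space M D. (\<forall>v\<in>D. (LINT x|M. g x * v x) = 0) \<longrightarrow> (AE x in M. g x = 0))"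

text \<open>
  The identity
  \<open>1/2 \<integral>\<integral> \<phi>(x, y, uh(x) - uh(y)) (vh(x) - vh(y)) d\<mu>(y) d\<mu>(x) = \<integral> g vh d\<mu>\<close>, including the existence
  of its left-hand side, since a divergent integral would have value \<open>0\<close>.
\<close>

definition pv_identity ::
    "'a measure \<Rightarrow> ('a \<Rightarrow> 'a \<Rightarrow> real \<Rightarrow> real) \<Rightarrow>
     ('a \<Rightarrow> real) \<Rightarrow> ('a \<Rightarrow> real) \<Rightarrow> ('a \<Rightarrow> real) \<Rightarrow> bool" where
  "pv_identity M \<phi> uh g vh \<longleftrightarrow>
     integrable (M \<Otimes>\<^sub>M M) (\<lambda>(x, y). \<phi> x y (uh x - uh y) * (vh x - vh y)) \<and>
     1 / 2 * (LINT x|M. (LINT y|M. \<phi> x y (uh x - uh y) * (vh x - vh y)))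
       = (LINT x|M. g x * vh x)"

text \<open>
  \<open>uh\<close> is a weak solution of \<open>P.V. \<integral> \<phi>(x, y, uh(x) - uh(y)) d\<mu>(y) = g(x)\<close>, with \<open>D\<close> as the
  space of test functions.
\<close>

definition weak_solution ::
    "'a measure \<Rightarrow> ('a \<Rightarrow> 'a \<Rightarrow> real \<Rightarrow> real) \<Rightarrow> ('a \<Rightarrow> real) set \<Rightarrow>
     ('a \<Rightarrow> real) \<Rightarrow> ('a \<Rightarrow> real) \<Rightarrow> bool" where
  "weak_solution M \<phi> D g uh \<longleftrightarrow>
     g \<in> associate_space M D \<and> (\<forall>vh\<in>D. pv_identity M \<phi> uh g vh)"

text \<open>
  The weak principal value \<open>x \<mapsto> P.V. \<integral> \<phi>(x, y, uh(x) - uh(y)) d\<mu>(y)\<close>. If it exists and \<open>D\<close>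
  separates the points of its associate space, it is unique up to a null set.
\<close>

definition principal_value ::
    "'a measure \<Rightarrow> ('a \<Rightarrow> 'a \<Rightarrow> real \<Rightarrow> real) \<Rightarrow> ('a \<Rightarrow> real) set \<Rightarrow>
     ('a \<Rightarrow> real) \<Rightarrow> 'a \<Rightarrow> real" where
  "principal_value M \<phi> D uh = (SOME g. weak_solution M \<phi> D g uh)"

text \<open>
  \<open>uh\<close> restricts to \<open>u\<close>, solves the equations with right-hand sides \<open>f\<close> in \<open>\<Omega>\<close> and \<open>0\<close> off \<open>\<Omega>\<close>
  (one equation on \<open>space M\<close>) and its principal value may be tested with all of \<open>W2 M \<Omega> \<Phi>\<close>.
\<close>

definition pv_solution ::
    "'a measure \<Rightarrow> 'a set \<Rightarrow> ('a \<Rightarrow> 'a \<Rightarrow> real \<Rightarrow> ennreal) \<Rightarrow> ('a \<Rightarrow> 'a \<Rightarrow> real \<Rightarrow> real) \<Rightarrow>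
     ('a \<Rightarrow> real) set \<Rightarrow> ('a \<Rightarrow> real) \<Rightarrow> ('a \<Rightarrow> real) \<Rightarrow> ('a \<Rightarrow> real) \<Rightarrow> bool" where
  "pv_solution M \<Omega> \<Phi> \<phi> D u f uh \<longleftrightarrow>
     uh \<in> W2 M \<Omega> \<Phi> \<and> restricts_to M \<Omega> uh u \<and>
     weak_solution M \<phi> D (\<lambda>x. if x \<in> \<Omega> then f x else 0) uh \<and>
     (\<forall>vh\<in>W2 M \<Omega> \<Phi>. pv_identity M \<phi> uh (principal_value M \<phi> D uh) vh)"

end

theory Submission
  imports Defs
begin

text \<open>
  Since \<open>\<phi> x y\<close> is increasing, \<open>\<phi> x y s * (r - s) \<le> \<Phi> x y r - \<Phi> x y s\<close>. By the \<open>\<Delta>\<^sub>2\<close>-condition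
  the energy is finite on all of \<open>W2\<close>, so this tangent inequality makes
  \<open>\<phi>(x, y, u(x) - u(y)) (v(x) - v(y))\<close> integrable for \<open>u, v\<close> in \<open>W2\<close> and, after integration, shows
  that the variational equation tested with all of \<open>W2\<close> implies the subgradient inequality. Conversely,
  the subgradient inequality at \<open>t v\<close> and the tangent inequality at \<open>uh + t v\<close> give, as \<open>t\<close> decreases to
  \<open>0\<close>, one half of the variational equation; the other half is the case \<open>- v\<close>. Since the principal
  value is unique, this equation is the one defining \<open>pv_solution\<close>.

  For uniqueness, two elliptic extensions of \<open>u\<close> minimise the energy on \<open>j\<^sup>-\<^sup>1(u)\<close>, hence so does
  their midpoint, and strict convexity makes their difference \<open>d\<close> satisfy \<open>d(x) = d(y)\<close> almost
  everywhere on \<open>S_set M \<Phi>\<close>. As \<open>d = 0\<close> on \<open>\<Omega>\<close>, thickness propagates this value to the whole space.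
\<close>

section \<open>Caratheodory functions and square-integrable functions\<close>

text \<open>Rounding \<open>w\<close> down to a grid of step \<open>1 / Suc n\<close> leaves
  countably many values, so \<open>g x (a n x)\<close> is glued from countably many measurable
  functions. The rounded values tend to \<open>w\<close>, and continuity in the second variable
  carries measurability to the limit.\<close>

lemma borel_measurable_caratheodory:
  fixes g :: "'a \<Rightarrow> real \<Rightarrow> real"
  assumes meas: "\<And>s. (\<lambda>x. g x s) \<in> borel_measurable N"
    and cont: "\<And>x. x \<in> space N \<Longrightarrow> continuous_on UNIV (g x)"
    and w [measurable]: "w \<in> borel_measurable N"
  shows "(\<lambda>x. g x (w x)) \<in> borel_measurable N"
proof (rule borel_measurable_LIMSEQ_real)
  define a where "a = (\<lambda>n x. of_int \<lfloor>real (Suc n) * w x\<rfloor> / real (Suc n))"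
  show "(\<lambda>x. g x (a n x)) \<in> borel_measurable N" for n
    unfolding a_def
    by (rule measurable_compose_countable[where f = "\<lambda>i x. g x (of_int i / real (Suc n))"])
      (simp_all add: meas)
  show "(\<lambda>n. g x (a n x)) \<longlonglongrightarrow> g x (w x)" if "x \<in> space N" for x
  proof -
    have "(\<lambda>n. a n x) \<longlonglongrightarrow> w x"
    proof (rule tendsto_sandwich)
      have "(\<lambda>n. w x - inverse (real (Suc n))) \<longlonglongrightarrow> w x - 0"
        by (intro tendsto_intros LIMSEQ_inverse_real_of_nat)
      then show "(\<lambda>n. w x - inverse (real (Suc n))) \<longlonglongrightarrow> w x" by simp
      show "\<forall>\<^sub>F n in sequentially. w x - inverse (real (Suc n)) \<le> a n x"
      proof (rule always_eventually, rule allI)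
        fix n
        have "(real (Suc n) * w x - 1) / real (Suc n) \<le> a n x"
          unfolding a_def by (intro divide_right_mono) linarith+
        then show "w x - inverse (real (Suc n)) \<le> a n x"
          by (simp add: field_simps)
      qed
      show "\<forall>\<^sub>F n in sequentially. a n x \<le> w x"
      proof (rule always_eventually, rule allI)
        fix n
        have "a n x \<le> (real (Suc n) * w x) / real (Suc n)"
          unfolding a_def by (intro divide_right_mono) linarith+
        then show "a n x \<le> w x" by simp
      qed
    qed simp
    moreover have "isCont (g x) (w x)"
      using cont[OF that] by (simp add: continuous_on_eq_continuous_at)
    ultimately show ?thesis by (rule isCont_tendsto_compose[rotated])
  qed
qed

lemma L2_add:
  assumes "u \<in> L2 N" "v \<in> L2 N"
  shows "(\<lambda>x. u x + v x) \<in> L2 N"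
proof -
  have [measurable]: "u \<in> borel_measurable N" "v \<in> borel_measurable N"
    using assms by (auto simp: L2_def)
  have "integrable N (\<lambda>x. 2 * (u x)\<^sup>2 + 2 * (v x)\<^sup>2)"
    using assms by (auto simp: L2_def)
  then have "integrable N (\<lambda>x. (u x + v x)\<^sup>2)"
  proof (rule Bochner_Integration.integrable_bound)
    show "AE x in N. norm ((u x + v x)\<^sup>2) \<le> norm (2 * (u x)\<^sup>2 + 2 * (v x)\<^sup>2)"
    proof (rule AE_I2)
      fix x
      have "0 \<le> (u x - v x)\<^sup>2" by simp
      then have "(u x + v x)\<^sup>2 \<le> 2 * (u x)\<^sup>2 + 2 * (v x)\<^sup>2"
        by (simp add: power2_eq_square algebra_simps)
      then show "norm ((u x + v x)\<^sup>2) \<le> norm (2 * (u x)\<^sup>2 + 2 * (v x)\<^sup>2)" by simp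
    qed
  qed simp
  then show ?thesis by (simp add: L2_def)
qed

lemma L2_scale: "u \<in> L2 N \<Longrightarrow> (\<lambda>x. c * u x) \<in> L2 N"
  by (auto simp: L2_def power_mult_distrib)

lemma L2_mult_integrable:
  assumes "u \<in> L2 N" "v \<in> L2 N"
  shows "integrable N (\<lambda>x. u x * v x)"
proof -
  have [measurable]: "u \<in> borel_measurable N" "v \<in> borel_measurable N"
    using assms by (auto simp: L2_def)
  have "integrable N (\<lambda>x. (u x)\<^sup>2 + (v x)\<^sup>2)"
    using assms by (auto simp: L2_def)
  then show ?thesis
  proof (rule Bochner_Integration.integrable_bound)
    show "AE x in N. norm (u x * v x) \<le> norm ((u x)\<^sup>2 + (v x)\<^sup>2)"
    proof (rule AE_I2)
      fix x
      have "0 \<le> (\<bar>u x\<bar> - \<bar>v x\<bar>)\<^sup>2" "0 \<le> \<bar>u x\<bar> * \<bar>v x\<bar>" by simp_all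
      then have "\<bar>u x\<bar> * \<bar>v x\<bar> \<le> \<bar>u x\<bar>\<^sup>2 + \<bar>v x\<bar>\<^sup>2"
        unfolding power2_diff by linarith
      then show "norm (u x * v x) \<le> norm ((u x)\<^sup>2 + (v x)\<^sup>2)"
        by (simp add: abs_mult)
    qed
  qed simp
qed

section \<open>Primitive, energy density and flux\<close>

locale nonlocal_energy = sigma_finite_measure M
  for M :: "'a measure" +
  fixes \<Omega> :: "'a set"
    and \<Phi> :: "'a \<Rightarrow> 'a \<Rightarrow> real \<Rightarrow> ennreal"
    and \<phi> :: "'a \<Rightarrow> 'a \<Rightarrow> real \<Rightarrow> real"
  assumes sets_Omega [measurable]: "\<Omega> \<in> sets M"
    and cond_C: "condition_C M \<Phi>"
    and delta2: "delta2_condition M \<Phi>"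
    and cond_D: "condition_D M \<Phi> \<phi>"
begin

sublocale pair: pair_sigma_finite M M ..

text \<open>Condition (D) makes \<open>\<Phi>\<close> finite on the space. Its real value gets a
  name so that derivatives and differences can be taken in \<open>real\<close> rather than
  \<open>ennreal\<close>.\<close>

definition primitive :: "'a \<Rightarrow> 'a \<Rightarrow> real \<Rightarrow> real" where
  "primitive x y s = (LBINT \<tau>=0..s. \<phi> x y \<tau>)"

text \<open>The integrand of twice the energy, as a single function on the product space, where
  domination and convergence theorems apply directly.\<close>

definition energy_density :: "('a \<Rightarrow> real) \<Rightarrow> 'a \<times> 'a \<Rightarrow> real" where
  "energy_density u p = primitive (fst p) (snd p) (u (fst p) - u (snd p))"

text \<open>The integrand of the directional derivative of twice the energy at \<open>u\<close> in
  direction \<open>v\<close>.\<close>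

definition flux :: "('a \<Rightarrow> real) \<Rightarrow> ('a \<Rightarrow> real) \<Rightarrow> 'a \<times> 'a \<Rightarrow> real" where
  "flux u v p = \<phi> (fst p) (snd p) (u (fst p) - u (snd p)) * (v (fst p) - v (snd p))"

lemma phi_continuous: "x \<in> space M \<Longrightarrow> y \<in> space M \<Longrightarrow> continuous_on UNIV (\<phi> x y)"
  and phi_mono: "x \<in> space M \<Longrightarrow> y \<in> space M \<Longrightarrow> mono (\<phi> x y)"
  and phi_zero: "x \<in> space M \<Longrightarrow> y \<in> space M \<Longrightarrow> \<phi> x y 0 = 0"
  and Phi_primitive: "x \<in> space M \<Longrightarrow> y \<in> space M \<Longrightarrow> \<Phi> x y s = ennreal (primitive x y s)"
  and phi_measurable: "(\<lambda>p. \<phi> (fst p) (snd p) s) \<in> borel_measurable (M \<Otimes>\<^sub>M M)"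
  using cond_D unfolding condition_D_def primitive_def by (auto simp: case_prod_unfold)

lemma Phi_even: "x \<in> space M \<Longrightarrow> y \<in> space M \<Longrightarrow> \<Phi> x y (- s) = \<Phi> x y s"
  and Phi_measurable: "(\<lambda>p. \<Phi> (fst p) (snd p) s) \<in> borel_measurable (M \<Otimes>\<^sub>M M)"
  using cond_C unfolding condition_C_def by (auto simp: case_prod_unfold)

lemma primitive_zero [simp]: "primitive x y 0 = 0"
  by (simp add: primitive_def zero_ereal_def)

lemma primitive_DERIV:
  assumes "x \<in> space M" "y \<in> space M"
  shows "(primitive x y has_real_derivative \<phi> x y s) (at s)"
proof -
  \<comment> \<open>The interval contains \<open>0\<close> and has \<open>s\<close> in its interior,
    so the derivative within it is the full derivative at \<open>s\<close>.\<close>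
  define a where "a = - \<bar>s\<bar> - 1"
  define b where "b = \<bar>s\<bar> + 1"
  have "((\<lambda>r. LBINT \<tau>=ereal 0..r. \<phi> x y \<tau>) has_vector_derivative \<phi> x y s) (at s within {a..b})"
    by (rule interval_integral_FTC2)
      (auto simp: a_def b_def intro: continuous_on_subset[OF phi_continuous[OF assms]])
  moreover have "at s within {a..b} = at s"
    by (rule at_within_interior) (auto simp: a_def b_def)
  ultimately show ?thesis
    by (simp add: primitive_def[abs_def] zero_ereal_def has_real_derivative_iff_has_vector_derivative)
qed

text \<open>By the mean value theorem the increment is \<open>r - s\<close> times a value of
  \<open>\<phi> x y\<close> between the two points; monotonicity compares that value with the one at
  \<open>s\<close>, on either side of \<open>s\<close>.\<close>

lemma primitive_tangent:
  assumes "x \<in> space M" "y \<in> space M"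
  shows "\<phi> x y s * (r - s) \<le> primitive x y r - primitive x y s"
proof (cases s r rule: linorder_cases)
  case less
  then obtain z where "s < z" "z < r" "primitive x y r - primitive x y s = (r - s) * \<phi> x y z"
    using MVT2[of s r "primitive x y" "\<phi> x y"] primitive_DERIV[OF assms] by auto
  moreover from this have "\<phi> x y s \<le> \<phi> x y z"
    using phi_mono[OF assms] by (auto simp: mono_def)
  ultimately show ?thesis
    using less by (simp add: mult.commute mult_left_mono)
next
  case greater
  then obtain z where "r < z" "z < s" "primitive x y s - primitive x y r = (s - r) * \<phi> x y z"
    using MVT2[of r s "primitive x y" "\<phi> x y"] primitive_DERIV[OF assms] by auto
  moreover from this have "\<phi> x y z \<le> \<phi> x y s"
    using phi_mono[OF assms] by (auto simp: mono_def)
  then have "(s - r) * \<phi> x y z \<le> (s - r) * \<phi> x y s"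
    using greater by (simp add: mult_left_mono)
  ultimately show ?thesis by (simp add: algebra_simps)
qed simp

text \<open>The tangent at \<open>0\<close> is horizontal, because \<open>\<phi> x y\<close>
  vanishes there.\<close>

lemma primitive_nonneg:
  assumes "x \<in> space M" "y \<in> space M"
  shows "0 \<le> primitive x y s"
  using primitive_tangent[OF assms, of 0 s] by (simp add: phi_zero assms)

lemma energy_density_nonneg: "p \<in> space (M \<Otimes>\<^sub>M M) \<Longrightarrow> 0 \<le> energy_density u p"
  by (auto simp: energy_density_def space_pair_measure primitive_nonneg)

lemma Phi_energy_density:
  "x \<in> space M \<Longrightarrow> y \<in> space M \<Longrightarrow> \<Phi> x y (u x - u y) = ennreal (energy_density u (x, y))"
  by (simp add: energy_density_def Phi_primitive)

lemma energy_density_tangent: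
  assumes "p \<in> space (M \<Otimes>\<^sub>M M)"
  shows "flux u v p \<le> energy_density (\<lambda>x. u x + v x) p - energy_density u p"
  using primitive_tangent[of "fst p" "snd p" "u (fst p) - u (snd p)"
      "u (fst p) + v (fst p) - (u (snd p) + v (snd p))"] assms
  by (auto simp: energy_density_def flux_def space_pair_measure algebra_simps)

lemma flux_minus: "flux u (\<lambda>x. - v x) p = - flux u v p"
  by (simp add: flux_def algebra_simps)

lemma flux_scale: "flux u (\<lambda>x. c * v x) p = c * flux u v p"
  by (simp add: flux_def algebra_simps)

section \<open>Measurability and integrals of flux and density\<close>

text \<open>Condition (D) gives measurability of \<open>\<phi>\<close> for fixed third argument
  only; continuity in that argument allows \<open>u x - u y\<close> to be inserted.\<close>

lemma flux_measurable [measurable]: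
  assumes [measurable]: "u \<in> borel_measurable M" "v \<in> borel_measurable M"
  shows "flux u v \<in> borel_measurable (M \<Otimes>\<^sub>M M)"
proof -
  have "(\<lambda>p. \<phi> (fst p) (snd p) (u (fst p) - u (snd p))) \<in> borel_measurable (M \<Otimes>\<^sub>M M)"
    by (rule borel_measurable_caratheodory)
      (auto intro: phi_measurable phi_continuous simp: space_pair_measure)
  then show ?thesis
    unfolding flux_def[abs_def] by measurable
qed

lemma energy_density_measurable [measurable]:
  assumes [measurable]: "u \<in> borel_measurable M"
  shows "energy_density u \<in> borel_measurable (M \<Otimes>\<^sub>M M)"
  unfolding energy_density_def[abs_def]
proof (rule borel_measurable_caratheodory[where g = "\<lambda>p. primitive (fst p) (snd p)"])
  fix s
  \<comment> \<open>For fixed \<open>s\<close>, measurability is read off from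
    \<open>\<Phi>\<close>, whose real value \<open>primitive\<close> is, instead of from an integral
    with a parameter.\<close>
  have "(\<lambda>p. enn2real (\<Phi> (fst p) (snd p) s)) \<in> borel_measurable (M \<Otimes>\<^sub>M M)"
    by (intro borel_measurable_enn2real Phi_measurable)
  also have "?this \<longleftrightarrow> (\<lambda>p. primitive (fst p) (snd p) s) \<in> borel_measurable (M \<Otimes>\<^sub>M M)"
    by (intro measurable_cong) (auto simp: Phi_primitive primitive_nonneg space_pair_measure)
  finally show "(\<lambda>p. primitive (fst p) (snd p) s) \<in> borel_measurable (M \<Otimes>\<^sub>M M)" .
next
  show "continuous_on UNIV (primitive (fst p) (snd p))" if "p \<in> space (M \<Otimes>\<^sub>M M)" for p
    using that
    by (auto simp: space_pair_measure continuous_on_eq_continuous_at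
        intro!: DERIV_isCont[OF primitive_DERIV])
qed measurable

lemma double_nn_integral_energy_density:
  assumes [measurable]: "u \<in> borel_measurable M"
  shows "(\<integral>\<^sup>+ x. (\<integral>\<^sup>+ y. \<Phi> x y (u x - u y) \<partial>M) \<partial>M) = (\<integral>\<^sup>+ p. ennreal (energy_density u p) \<partial>(M \<Otimes>\<^sub>M M))"
proof -
  have "(\<integral>\<^sup>+ x. (\<integral>\<^sup>+ y. \<Phi> x y (u x - u y) \<partial>M) \<partial>M) = (\<integral>\<^sup>+ x. (\<integral>\<^sup>+ y. ennreal (energy_density u (x, y)) \<partial>M) \<partial>M)"
    by (intro nn_integral_cong) (simp add: Phi_energy_density)
  also have "\<dots> = (\<integral>\<^sup>+ p. ennreal (energy_density u p) \<partial>(M \<Otimes>\<^sub>M M))"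
    by (rule nn_integral_fst[of "\<lambda>p. ennreal (energy_density u p)"]) measurable
  finally show ?thesis .
qed

lemma energy_density_integrable_iff:
  assumes [measurable]: "u \<in> borel_measurable M"
  shows "integrable (M \<Otimes>\<^sub>M M) (energy_density u) \<longleftrightarrow>
    (\<integral>\<^sup>+ x. (\<integral>\<^sup>+ y. \<Phi> x y (u x - u y) \<partial>M) \<partial>M) < \<infinity>"
proof -
  have "(\<integral>\<^sup>+ p. ennreal (norm (energy_density u p)) \<partial>(M \<Otimes>\<^sub>M M))
      = (\<integral>\<^sup>+ p. ennreal (energy_density u p) \<partial>(M \<Otimes>\<^sub>M M))"
    by (intro nn_integral_cong) (simp add: energy_density_nonneg)
  then show ?thesis
    by (simp add: double_nn_integral_energy_density integrable_iff_bounded)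
qed

section \<open>Linear structure and finite energy of \<open>W0\<close> and \<open>W2\<close>\<close>

text \<open>The \<open>\<Delta>\<^sub>2\<close>-condition supplies the integrable majorant
  \<open>K * energy_density u p + h p\<close>.\<close>

lemma energy_density_double_integrable:
  assumes [measurable]: "u \<in> borel_measurable M"
    and int: "integrable (M \<Otimes>\<^sub>M M) (energy_density u)"
  shows "integrable (M \<Otimes>\<^sub>M M) (energy_density (\<lambda>x. 2 * u x))"
proof -
  obtain K h where K: "K > 0" and h: "integrable (M \<Otimes>\<^sub>M M) h"
    and bound: "\<And>x y s. x \<in> space M \<Longrightarrow> y \<in> space M \<Longrightarrow>
      0 \<le> h (x, y) \<and> \<Phi> x y (2 * s) \<le> ennreal K * \<Phi> x y s + ennreal (h (x, y))"
    using delta2 unfolding delta2_condition_def by blast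
  have "integrable (M \<Otimes>\<^sub>M M) (\<lambda>p. K * energy_density u p + h p)"
    using int h by auto
  then show ?thesis
  proof (rule Bochner_Integration.integrable_bound)
    show "AE p in M \<Otimes>\<^sub>M M. norm (energy_density (\<lambda>x. 2 * u x) p) \<le> norm (K * energy_density u p + h p)"
    proof (rule AE_I2)
      fix p assume p: "p \<in> space (M \<Otimes>\<^sub>M M)"
      obtain x y where xy: "p = (x, y)" "x \<in> space M" "y \<in> space M"
        using p by (auto simp: space_pair_measure)
      have "ennreal (energy_density (\<lambda>x. 2 * u x) p) \<le> ennreal K * ennreal (energy_density u p) + ennreal (h p)"
        using bound[of x y "u x - u y"] xy
        by (simp add: Phi_energy_density[symmetric] right_diff_distrib)
      also have "\<dots> = ennreal (K * energy_density u p + h p)"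
        using K energy_density_nonneg[OF p, of u] bound xy by (simp add: ennreal_mult ennreal_plus)
      finally have "energy_density (\<lambda>x. 2 * u x) p \<le> K * energy_density u p + h p"
        using K energy_density_nonneg[OF p, of u] bound xy by (subst (asm) ennreal_le_iff) auto
      then show "norm (energy_density (\<lambda>x. 2 * u x) p) \<le> norm (K * energy_density u p + h p)"
        using energy_density_nonneg[OF p, of "\<lambda>x. 2 * u x"] by simp
    qed
  qed measurable
qed

text \<open>The tangent inequalities at the weighted mean \<open>c\<close>, towards \<open>s\<close>
  and towards \<open>r\<close>, are added with the weights; the first-order terms cancel.\<close>

lemma primitive_convex:
  assumes "x \<in> space M" "y \<in> space M" "0 \<le> t" "t \<le> 1"
  shows "primitive x y ((1 - t) * s + t * r) \<le> (1 - t) * primitive x y s + t * primitive x y r"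
proof -
  define c where "c = (1 - t) * s + t * r"
  have "(1 - t) * (\<phi> x y c * (s - c)) + t * (\<phi> x y c * (r - c))
      \<le> (1 - t) * (primitive x y s - primitive x y c) + t * (primitive x y r - primitive x y c)"
    using assms by (intro add_mono mult_left_mono primitive_tangent) auto
  moreover have "(1 - t) * (\<phi> x y c * (s - c)) + t * (\<phi> x y c * (r - c)) = 0"
    unfolding c_def by algebra
  ultimately show ?thesis
    unfolding c_def[symmetric] by (simp add: algebra_simps)
qed

text \<open>Membership only asks for finite energy at some scale \<open>c\<close>. Repeated
  doubling, harmless by the \<open>\<Delta>\<^sub>2\<close>-condition, brings the scale below
  \<open>1\<close>, and convexity leads back to scale \<open>1\<close>.\<close>

lemma W0_iff: "u \<in> W0 M \<Phi> \<longleftrightarrow> u \<in> borel_measurable M \<and> integrable (M \<Otimes>\<^sub>M M) (energy_density u)"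
proof
  assume "u \<in> W0 M \<Phi>"
  then obtain c where u [measurable]: "u \<in> borel_measurable M" and c: "c > 0"
    and fin: "(\<integral>\<^sup>+ x. (\<integral>\<^sup>+ y. \<Phi> x y ((u x - u y) / c) \<partial>M) \<partial>M) < \<infinity>"
    by (auto simp: W0_def)
  have *: "integrable (M \<Otimes>\<^sub>M M) (energy_density (\<lambda>x. 2 ^ n * (u x / c)))" for n
  proof (induction n)
    case 0
    show ?case
      using fin by (subst energy_density_integrable_iff) (auto simp: diff_divide_distrib)
  next
    case (Suc n)
    from energy_density_double_integrable[OF _ this] show ?case by (simp add: mult.assoc)
  qed
  \<comment> \<open>After enough doublings \<open>u\<close> is a multiple
    \<open>\<theta> * v\<close> of the doubled function with \<open>\<theta> \<le> 1\<close>.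
    Convexity between \<open>0\<close> and the increment of \<open>v\<close>, with value
    \<open>0\<close> at \<open>0\<close>, then bounds the density of \<open>u\<close> by that of
    \<open>v\<close>.\<close>
  obtain n where "c < 2 ^ n"
    using real_arch_pow[of 2 c] by auto
  define v where "v = (\<lambda>x. 2 ^ n * (u x / c))"
  define \<theta> where "\<theta> = c / 2 ^ n"
  have \<theta>: "0 \<le> \<theta>" "\<theta> \<le> 1" "\<And>x. u x = \<theta> * v x"
    using c \<open>c < 2 ^ n\<close> by (auto simp: \<theta>_def v_def)
  have "integrable (M \<Otimes>\<^sub>M M) (energy_density v)"
    using * by (simp add: v_def)
  then have "integrable (M \<Otimes>\<^sub>M M) (energy_density u)"
  proof (rule Bochner_Integration.integrable_bound)
    show "AE p in M \<Otimes>\<^sub>M M. norm (energy_density u p) \<le> norm (energy_density v p)"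
    proof (rule AE_I2)
      fix p assume p: "p \<in> space (M \<Otimes>\<^sub>M M)"
      then have "energy_density u p \<le> \<theta> * energy_density v p"
        using primitive_convex[of "fst p" "snd p" \<theta> 0 "v (fst p) - v (snd p)"] \<theta>
        by (auto simp: energy_density_def space_pair_measure right_diff_distrib)
      also have "\<dots> \<le> energy_density v p"
        using \<theta> energy_density_nonneg[OF p] by (simp add: mult_left_le_one_le)
      finally show "norm (energy_density u p) \<le> norm (energy_density v p)"
        using energy_density_nonneg[OF p] by simp
    qed
  qed measurable
  with u show "u \<in> borel_measurable M \<and> integrable (M \<Otimes>\<^sub>M M) (energy_density u)" by simp
next
  assume "u \<in> borel_measurable M \<and> integrable (M \<Otimes>\<^sub>M M) (energy_density u)"
  then show "u \<in> W0 M \<Phi>"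
    by (auto simp: W0_def energy_density_integrable_iff intro!: exI[of _ 1])
qed

text \<open>The sum is the midpoint of \<open>2 * u\<close> and \<open>2 * v\<close>, so convexity
  and the doubling estimate give a majorant.\<close>

lemma W0_add:
  assumes "u \<in> W0 M \<Phi>" "v \<in> W0 M \<Phi>"
  shows "(\<lambda>x. u x + v x) \<in> W0 M \<Phi>"
proof -
  have [measurable]: "u \<in> borel_measurable M" "v \<in> borel_measurable M"
    and int: "integrable (M \<Otimes>\<^sub>M M) (energy_density u)" "integrable (M \<Otimes>\<^sub>M M) (energy_density v)"
    using assms by (auto simp: W0_iff)
  have "integrable (M \<Otimes>\<^sub>M M)
      (\<lambda>p. (1 / 2) * energy_density (\<lambda>x. 2 * u x) p + (1 / 2) * energy_density (\<lambda>x. 2 * v x) p)"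
    using int by (intro Bochner_Integration.integrable_add integrable_mult_right
        energy_density_double_integrable) auto
  then have "integrable (M \<Otimes>\<^sub>M M) (energy_density (\<lambda>x. u x + v x))"
  proof (rule Bochner_Integration.integrable_bound)
    show "AE p in M \<Otimes>\<^sub>M M. norm (energy_density (\<lambda>x. u x + v x) p)
      \<le> norm ((1 / 2) * energy_density (\<lambda>x. 2 * u x) p + (1 / 2) * energy_density (\<lambda>x. 2 * v x) p)"
    proof (rule AE_I2)
      fix p assume p: "p \<in> space (M \<Otimes>\<^sub>M M)"
      have "energy_density (\<lambda>x. u x + v x) p
          \<le> (1 / 2) * energy_density (\<lambda>x. 2 * u x) p + (1 / 2) * energy_density (\<lambda>x. 2 * v x) p"
        using p primitive_convex[of "fst p" "snd p" "1 / 2" "2 * u (fst p) - 2 * u (snd p)"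
            "2 * v (fst p) - 2 * v (snd p)"]
        by (auto simp: energy_density_def space_pair_measure algebra_simps)
      then show "norm (energy_density (\<lambda>x. u x + v x) p)
          \<le> norm ((1 / 2) * energy_density (\<lambda>x. 2 * u x) p + (1 / 2) * energy_density (\<lambda>x. 2 * v x) p)"
        using energy_density_nonneg[OF p] by simp
    qed
  qed measurable
  then show ?thesis by (simp add: W0_iff)
qed

text \<open>The free scale in \<open>W0\<close> absorbs the factor: \<open>c * u\<close> at scale
  \<open>\<bar>c\<bar> * d\<close> has the integral of \<open>u\<close> at scale \<open>d\<close>,
  the sign of \<open>c\<close> being removed by evenness. For \<open>c = 0\<close> this scale would
  not be positive, whence the case split.\<close>

lemma W0_scale:
  assumes "u \<in> W0 M \<Phi>"
  shows "(\<lambda>x. c * u x) \<in> W0 M \<Phi>"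
proof (cases "c = 0")
  case True
  then show ?thesis by (auto simp: W0_iff energy_density_def[abs_def])
next
  case False
  obtain d where d: "d > 0" and u: "u \<in> borel_measurable M"
    and fin: "(\<integral>\<^sup>+ x. (\<integral>\<^sup>+ y. \<Phi> x y ((u x - u y) / d) \<partial>M) \<partial>M) < \<infinity>"
    using assms by (auto simp: W0_def)
  have "\<Phi> x y ((c * u x - c * u y) / (\<bar>c\<bar> * d)) = \<Phi> x y ((u x - u y) / d)"
    if "x \<in> space M" "y \<in> space M" for x y
  proof (cases "c > 0")
    case True
    then show ?thesis by (simp add: right_diff_distrib[symmetric])
  next
    case False
    with \<open>c \<noteq> 0\<close> have "(c * u x - c * u y) / (\<bar>c\<bar> * d) = - ((u x - u y) / d)"
      by (simp add: right_diff_distrib[symmetric])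
    then show ?thesis by (simp only: Phi_even[OF that])
  qed
  then have "(\<integral>\<^sup>+ x. (\<integral>\<^sup>+ y. \<Phi> x y ((c * u x - c * u y) / (\<bar>c\<bar> * d)) \<partial>M) \<partial>M)
      = (\<integral>\<^sup>+ x. (\<integral>\<^sup>+ y. \<Phi> x y ((u x - u y) / d) \<partial>M) \<partial>M)"
    by (intro nn_integral_cong) auto
  with fin d False u show ?thesis
    by (auto simp: W0_def intro!: exI[of _ "\<bar>c\<bar> * d"])
qed

lemma W2_add: "u \<in> W2 M \<Omega> \<Phi> \<Longrightarrow> v \<in> W2 M \<Omega> \<Phi> \<Longrightarrow> (\<lambda>x. u x + v x) \<in> W2 M \<Omega> \<Phi>"
  by (simp add: W2_def W0_add L2_add)

lemma W2_scale: "u \<in> W2 M \<Omega> \<Phi> \<Longrightarrow> (\<lambda>x. c * u x) \<in> W2 M \<Omega> \<Phi>"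
  by (simp add: W2_def W0_scale L2_scale)

lemma W2_diff: "u \<in> W2 M \<Omega> \<Phi> \<Longrightarrow> v \<in> W2 M \<Omega> \<Phi> \<Longrightarrow> (\<lambda>x. u x - v x) \<in> W2 M \<Omega> \<Phi>"
  using W2_add[OF _ W2_scale[of v "-1"], of u] by simp

lemma W2_measurable: "u \<in> W2 M \<Omega> \<Phi> \<Longrightarrow> u \<in> borel_measurable M"
  and W2_energy_density_integrable: "u \<in> W2 M \<Omega> \<Phi> \<Longrightarrow> integrable (M \<Otimes>\<^sub>M M) (energy_density u)"
  by (auto simp: W2_def W0_iff)

text \<open>Every member of \<open>W2\<close> has finite energy, so the differences of energies in
  the subgradient inequality become differences of real integrals.\<close>

lemma energy_eq:
  assumes "u \<in> W2 M \<Omega> \<Phi>"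
  shows "energy M \<Phi> u = ennreal (integral\<^sup>L (M \<Otimes>\<^sub>M M) (energy_density u) / 2)"
proof -
  have "(\<integral>\<^sup>+ p. ennreal (energy_density u p) \<partial>(M \<Otimes>\<^sub>M M)) = ennreal (integral\<^sup>L (M \<Otimes>\<^sub>M M) (energy_density u))"
    by (rule nn_integral_eq_integral[OF W2_energy_density_integrable[OF assms]])
      (auto intro: AE_I2 energy_density_nonneg)
  moreover have "0 \<le> integral\<^sup>L (M \<Otimes>\<^sub>M M) (energy_density u)"
    by (rule integral_nonneg_AE) (auto intro: AE_I2 energy_density_nonneg)
  ultimately show ?thesis
    unfolding energy_def double_nn_integral_energy_density[OF W2_measurable[OF assms]]
    by (simp add: divide_ennreal[symmetric])
qed

lemma enn2ereal_energy:
  assumes "u \<in> W2 M \<Omega> \<Phi>"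
  shows "enn2ereal (energy M \<Phi> u) = ereal (integral\<^sup>L (M \<Otimes>\<^sub>M M) (energy_density u) / 2)"
proof -
  have "0 \<le> integral\<^sup>L (M \<Otimes>\<^sub>M M) (energy_density u)"
    by (rule integral_nonneg_AE) (auto intro: AE_I2 energy_density_nonneg)
  then show ?thesis by (simp add: energy_eq[OF assms])
qed

section \<open>First variation of the energy\<close>

text \<open>The tangent inequality in the directions \<open>v\<close> and \<open>- v\<close> bounds
  the flux from above and from below by densities of members of \<open>W2\<close>.\<close>

lemma flux_integrable:
  assumes "u \<in> W2 M \<Omega> \<Phi>" "v \<in> W2 M \<Omega> \<Phi>"
  shows "integrable (M \<Otimes>\<^sub>M M) (flux u v)"
proof -
  note [measurable] = assms[THEN W2_measurable]
  have "integrable (M \<Otimes>\<^sub>M M)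
      (\<lambda>p. energy_density (\<lambda>x. u x + v x) p + energy_density (\<lambda>x. u x - v x) p + energy_density u p)"
    using assms by (intro Bochner_Integration.integrable_add W2_energy_density_integrable W2_add W2_diff)
  then show ?thesis
  proof (rule Bochner_Integration.integrable_bound)
    show "AE p in M \<Otimes>\<^sub>M M. norm (flux u v p)
        \<le> norm (energy_density (\<lambda>x. u x + v x) p + energy_density (\<lambda>x. u x - v x) p + energy_density u p)"
    proof (rule AE_I2)
      fix p assume p: "p \<in> space (M \<Otimes>\<^sub>M M)"
      have "flux u v p \<le> energy_density (\<lambda>x. u x + v x) p - energy_density u p"
        by (rule energy_density_tangent[OF p])
      moreover have "- flux u v p \<le> energy_density (\<lambda>x. u x - v x) p - energy_density u p"
        using energy_density_tangent[OF p, of u "\<lambda>x. - v x"] by (simp add: flux_minus)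
      ultimately show "norm (flux u v p)
        \<le> norm (energy_density (\<lambda>x. u x + v x) p + energy_density (\<lambda>x. u x - v x) p + energy_density u p)"
        using energy_density_nonneg[OF p, of u] energy_density_nonneg[OF p, of "\<lambda>x. u x + v x"]
          energy_density_nonneg[OF p, of "\<lambda>x. u x - v x"] unfolding real_norm_def by linarith
    qed
  qed measurable
qed

lemma flux_integral_le:
  assumes "u \<in> W2 M \<Omega> \<Phi>" "v \<in> W2 M \<Omega> \<Phi>"
  shows "integral\<^sup>L (M \<Otimes>\<^sub>M M) (flux u v)
    \<le> integral\<^sup>L (M \<Otimes>\<^sub>M M) (energy_density (\<lambda>x. u x + v x)) - integral\<^sup>L (M \<Otimes>\<^sub>M M) (energy_density u)"
proof -
  have "integral\<^sup>L (M \<Otimes>\<^sub>M M) (flux u v)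
      \<le> (LINT p|(M \<Otimes>\<^sub>M M). energy_density (\<lambda>x. u x + v x) p - energy_density u p)"
    using assms by (intro integral_mono Bochner_Integration.integrable_diff flux_integrable
        W2_energy_density_integrable W2_add energy_density_tangent)
  also have "\<dots> = integral\<^sup>L (M \<Otimes>\<^sub>M M) (energy_density (\<lambda>x. u x + v x))
      - integral\<^sup>L (M \<Otimes>\<^sub>M M) (energy_density u)"
    using assms by (intro Bochner_Integration.integral_diff W2_energy_density_integrable W2_add)
  finally show ?thesis .
qed

text \<open>The flux along \<open>u + t v\<close> is the derivative in \<open>t\<close> of a convex
  function. Concretely, the sign of the increment \<open>b\<close> of \<open>v\<close> decides
  whether the argument of \<open>\<phi>\<close> rises or falls with \<open>t\<close>, and the outer
  factor \<open>b\<close> corrects for it.\<close>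

lemma flux_mono:
  assumes "p \<in> space (M \<Otimes>\<^sub>M M)" "s \<le> t"
  shows "flux (\<lambda>x. u x + s * v x) v p \<le> flux (\<lambda>x. u x + t * v x) v p"
proof -
  define a where "a = u (fst p) - u (snd p)"
  define b where "b = v (fst p) - v (snd p)"
  have m: "mono (\<phi> (fst p) (snd p))"
    using assms by (auto simp: space_pair_measure phi_mono)
  have "\<phi> (fst p) (snd p) (a + s * b) * b \<le> \<phi> (fst p) (snd p) (a + t * b) * b"
  proof (cases "b \<ge> 0")
    case True
    then show ?thesis
      using assms by (intro mult_right_mono monoD[OF m] add_left_mono mult_right_mono) auto
  next
    case False
    then show ?thesis
      using assms by (intro mult_right_mono_neg monoD[OF m] add_left_mono mult_right_mono_neg) auto
  qed
  moreover have "a + r * b = u (fst p) + r * v (fst p) - (u (snd p) + r * v (snd p))" for r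
    by (simp add: a_def b_def algebra_simps)
  ultimately show ?thesis
    by (simp add: flux_def b_def)
qed

text \<open>By \<open>flux_mono\<close> the flux at \<open>u + t v\<close> with
  \<open>0 \<le> t \<le> 1\<close> lies between its values at \<open>t = 0\<close> and
  \<open>t = 1\<close>, which yields one integrable majorant. Pointwise convergence is continuity of
  \<open>\<phi> x y\<close>.\<close>

lemma flux_integral_tendsto:
  assumes "u \<in> W2 M \<Omega> \<Phi>" "v \<in> W2 M \<Omega> \<Phi>"
  shows "(\<lambda>n. integral\<^sup>L (M \<Otimes>\<^sub>M M) (flux (\<lambda>x. u x + inverse (real (Suc n)) * v x) v))
    \<longlonglongrightarrow> integral\<^sup>L (M \<Otimes>\<^sub>M M) (flux u v)"
proof (rule integral_dominated_convergence)
  note [measurable] = assms[THEN W2_measurable]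
  show "integrable (M \<Otimes>\<^sub>M M) (\<lambda>p. \<bar>flux u v p\<bar> + \<bar>flux (\<lambda>x. u x + v x) v p\<bar>)"
    using assms by (intro Bochner_Integration.integrable_add integrable_abs flux_integrable W2_add)
  show "flux u v \<in> borel_measurable (M \<Otimes>\<^sub>M M)" by measurable
  show "flux (\<lambda>x. u x + inverse (real (Suc n)) * v x) v \<in> borel_measurable (M \<Otimes>\<^sub>M M)" for n
    by measurable
  show "AE p in M \<Otimes>\<^sub>M M. norm (flux (\<lambda>x. u x + inverse (real (Suc n)) * v x) v p)
      \<le> \<bar>flux u v p\<bar> + \<bar>flux (\<lambda>x. u x + v x) v p\<bar>" for n
  proof (rule AE_I2)
    fix p assume p: "p \<in> space (M \<Otimes>\<^sub>M M)"
    have "inverse (real (Suc n)) \<le> 1" by (simp add: field_simps)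
    with flux_mono[OF p, of 0 "inverse (real (Suc n))" u v]
      flux_mono[OF p, of "inverse (real (Suc n))" 1 u v]
    show "norm (flux (\<lambda>x. u x + inverse (real (Suc n)) * v x) v p)
        \<le> \<bar>flux u v p\<bar> + \<bar>flux (\<lambda>x. u x + v x) v p\<bar>" by simp
  qed
  show "AE p in M \<Otimes>\<^sub>M M. (\<lambda>n. flux (\<lambda>x. u x + inverse (real (Suc n)) * v x) v p) \<longlonglongrightarrow> flux u v p"
  proof (rule AE_I2)
    fix p assume p: "p \<in> space (M \<Otimes>\<^sub>M M)"
    have cont: "isCont (\<phi> (fst p) (snd p)) (u (fst p) - u (snd p))"
      using phi_continuous[of "fst p" "snd p"] p
      by (auto simp: space_pair_measure continuous_on_eq_continuous_at)
    have "(\<lambda>n. u (fst p) + inverse (real (Suc n)) * v (fst p)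
        - (u (snd p) + inverse (real (Suc n)) * v (snd p)))
      \<longlonglongrightarrow> u (fst p) + 0 * v (fst p) - (u (snd p) + 0 * v (snd p))"
      by (intro tendsto_intros LIMSEQ_inverse_real_of_nat)
    then have "(\<lambda>n. \<phi> (fst p) (snd p) (u (fst p) + inverse (real (Suc n)) * v (fst p)
        - (u (snd p) + inverse (real (Suc n)) * v (snd p))))
      \<longlonglongrightarrow> \<phi> (fst p) (snd p) (u (fst p) - u (snd p))"
      using cont by (intro isCont_tendsto_compose[of _ "\<phi> (fst p) (snd p)"]) simp_all
    then show "(\<lambda>n. flux (\<lambda>x. u x + inverse (real (Suc n)) * v x) v p) \<longlonglongrightarrow> flux u v p"
      unfolding flux_def by (rule tendsto_mult_right)
  qed
qed

section \<open>The subgradient inequality as a variational equation\<close>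

lemma set_integral_extend_zero:
  "(LINT x:\<Omega>|M. f x * v x) = (LINT x|M. (if x \<in> \<Omega> then f x else 0) * v x)" for f v :: "'a \<Rightarrow> real"
  unfolding set_lebesgue_integral_def by (rule Bochner_Integration.integral_cong) auto

lemma extend_zero_integrable:
  assumes "f \<in> L2 (restrict_space M \<Omega>)" "v \<in> W2 M \<Omega> \<Phi>"
  shows "integrable M (\<lambda>x. (if x \<in> \<Omega> then f x else 0) * v x)"
proof -
  have "integrable (restrict_space M \<Omega>) (\<lambda>x. f x * v x)"
    using assms by (intro L2_mult_integrable) (auto simp: W2_def)
  then have "integrable M (\<lambda>x. indicator \<Omega> x *\<^sub>R (f x * v x))"
    by (subst (asm) integrable_restrict_space) auto
  also have "(\<lambda>x. indicator \<Omega> x *\<^sub>R (f x * v x)) = (\<lambda>x. (if x \<in> \<Omega> then f x else 0) * v x)"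
    by (auto simp: fun_eq_iff)
  finally show ?thesis .
qed

lemma extend_zero_associate:
  assumes "f \<in> L2 (restrict_space M \<Omega>)" "D \<subseteq> W2 M \<Omega> \<Phi>"
  shows "(\<lambda>x. if x \<in> \<Omega> then f x else 0) \<in> associate_space M D"
proof -
  have "f \<in> borel_measurable (restrict_space M \<Omega>)"
    using assms by (simp add: L2_def)
  then have "(\<lambda>x. indicator \<Omega> x *\<^sub>R f x) \<in> borel_measurable M"
    by (subst (asm) borel_measurable_restrict_space_iff) auto
  also have "(\<lambda>x. indicator \<Omega> x *\<^sub>R f x) = (\<lambda>x. if x \<in> \<Omega> then f x else 0)"
    by (auto simp: fun_eq_iff)
  finally show ?thesis
    using assms extend_zero_integrable by (auto simp: associate_space_def)
qed

text \<open>This is the Euler-Lagrange equation of the energy minus the linear term. The factor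
  \<open>2\<close> stems from the factor \<open>1/2\<close> in the energy.\<close>

lemma elliptic_extension_iff:
  assumes u: "u \<in> L2 (restrict_space M \<Omega>)" and f: "f \<in> L2 (restrict_space M \<Omega>)"
  shows "elliptic_extension M \<Omega> \<Phi> u f uh \<longleftrightarrow> uh \<in> W2 M \<Omega> \<Phi> \<and> restricts_to M \<Omega> uh u \<and>
    (\<forall>v\<in>W2 M \<Omega> \<Phi>. integral\<^sup>L (M \<Otimes>\<^sub>M M) (flux uh v) = 2 * (LINT x:\<Omega>|M. f x * v x))"
proof
  assume ell: "elliptic_extension M \<Omega> \<Phi> u f uh"
  then have uh: "uh \<in> W2 M \<Omega> \<Phi>" and restr: "restricts_to M \<Omega> uh u"
    and min: "\<And>v. v \<in> W2 M \<Omega> \<Phi> \<Longrightarrow>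
        enn2ereal (energy M \<Phi> (\<lambda>x. uh x + v x)) - enn2ereal (energy M \<Phi> uh)
          \<ge> ereal (LINT x:\<Omega>|M. f x * v x)"
    by (auto simp: elliptic_extension_def)
  have ge: "2 * (LINT x:\<Omega>|M. f x * v x) \<le> integral\<^sup>L (M \<Otimes>\<^sub>M M) (flux uh v)"
    if v: "v \<in> W2 M \<Omega> \<Phi>" for v
  proof (rule LIMSEQ_le_const[OF flux_integral_tendsto[OF uh v]], intro exI allI impI)
    fix n :: nat
    define t where "t = inverse (real (Suc n))"
    have t: "t > 0" by (simp add: t_def)
    define w where "w = (\<lambda>x. uh x + t * v x)"
    have tv: "(\<lambda>x. t * v x) \<in> W2 M \<Omega> \<Phi>" and mtv: "(\<lambda>x. - t * v x) \<in> W2 M \<Omega> \<Phi>"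
      using W2_scale[OF v] by blast+
    have w: "w \<in> W2 M \<Omega> \<Phi>"
      unfolding w_def using W2_add[OF uh tv] .
    have "(LINT x:\<Omega>|M. f x * (t * v x)) = t * (LINT x:\<Omega>|M. f x * v x)"
      unfolding set_lebesgue_integral_def
      by (subst Bochner_Integration.integral_mult_right_zero[symmetric])
        (simp add: mult.left_commute)
    then have "2 * (t * (LINT x:\<Omega>|M. f x * v x))
        \<le> integral\<^sup>L (M \<Otimes>\<^sub>M M) (energy_density w) - integral\<^sup>L (M \<Otimes>\<^sub>M M) (energy_density uh)"
      using min[OF tv] enn2ereal_energy[OF uh] enn2ereal_energy[OF w] by (simp add: w_def)
    \<comment> \<open>The tangent inequality is used at \<open>w\<close>, pointing back to
      \<open>uh\<close>: it bounds the energy difference from above by \<open>t\<close> times the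
      flux at \<open>w\<close>. Division by \<open>t\<close> leaves an inequality that survives the
      limit.\<close>
    moreover have "integral\<^sup>L (M \<Otimes>\<^sub>M M) (flux w (\<lambda>x. - t * v x))
        \<le> integral\<^sup>L (M \<Otimes>\<^sub>M M) (energy_density uh) - integral\<^sup>L (M \<Otimes>\<^sub>M M) (energy_density w)"
      using flux_integral_le[OF w mtv] by (simp add: w_def)
    moreover have "integral\<^sup>L (M \<Otimes>\<^sub>M M) (flux w (\<lambda>x. - t * v x))
        = - t * integral\<^sup>L (M \<Otimes>\<^sub>M M) (flux w v)"
      unfolding flux_scale[of w "- t" v, abs_def] by simp
    ultimately have "t * (2 * (LINT x:\<Omega>|M. f x * v x)) \<le> t * integral\<^sup>L (M \<Otimes>\<^sub>M M) (flux w v)"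
      by simp
    then show "2 * (LINT x:\<Omega>|M. f x * v x)
        \<le> integral\<^sup>L (M \<Otimes>\<^sub>M M) (flux (\<lambda>x. uh x + inverse (real (Suc n)) * v x) v)"
      using t by (simp add: w_def t_def)
  qed
  have "integral\<^sup>L (M \<Otimes>\<^sub>M M) (flux uh v) = 2 * (LINT x:\<Omega>|M. f x * v x)"
    if v: "v \<in> W2 M \<Omega> \<Phi>" for v
  proof (rule antisym[OF _ ge[OF v]])
    \<comment> \<open>Both sides are odd in \<open>v\<close>, so \<open>ge\<close> for
      \<open>- v\<close> is the reverse inequality.\<close>
    have "(\<lambda>x. - v x) \<in> W2 M \<Omega> \<Phi>"
      using W2_scale[OF v, of "-1"] by simp
    from ge[OF this] show "integral\<^sup>L (M \<Otimes>\<^sub>M M) (flux uh v) \<le> 2 * (LINT x:\<Omega>|M. f x * v x)"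
      unfolding flux_minus[of uh v, abs_def] by (simp add: set_lebesgue_integral_def)
  qed
  with uh restr show "uh \<in> W2 M \<Omega> \<Phi> \<and> restricts_to M \<Omega> uh u \<and>
    (\<forall>v\<in>W2 M \<Omega> \<Phi>. integral\<^sup>L (M \<Otimes>\<^sub>M M) (flux uh v) = 2 * (LINT x:\<Omega>|M. f x * v x))"
    by blast
next
  assume "uh \<in> W2 M \<Omega> \<Phi> \<and> restricts_to M \<Omega> uh u \<and>
    (\<forall>v\<in>W2 M \<Omega> \<Phi>. integral\<^sup>L (M \<Otimes>\<^sub>M M) (flux uh v) = 2 * (LINT x:\<Omega>|M. f x * v x))"
  then have uh: "uh \<in> W2 M \<Omega> \<Phi>" and restr: "restricts_to M \<Omega> uh u"
    and eq: "\<And>v. v \<in> W2 M \<Omega> \<Phi> \<Longrightarrow>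
      integral\<^sup>L (M \<Otimes>\<^sub>M M) (flux uh v) = 2 * (LINT x:\<Omega>|M. f x * v x)"
    by auto
  have "ereal (LINT x:\<Omega>|M. f x * v x)
      \<le> enn2ereal (energy M \<Phi> (\<lambda>x. uh x + v x)) - enn2ereal (energy M \<Phi> uh)"
    if v: "v \<in> W2 M \<Omega> \<Phi>" for v
    using flux_integral_le[OF uh v] eq[OF v]
    by (simp add: enn2ereal_energy[OF uh] enn2ereal_energy[OF W2_add[OF uh v]])
  then show "elliptic_extension M \<Omega> \<Phi> u f uh"
    using u f uh restr by (simp add: elliptic_extension_def energy_eq)
qed

section \<open>The weak principal value\<close>

text \<open>Fubini's theorem identifies the iterated integral with the one on the product space; the
  integrability clause is \<open>flux_integrable\<close>.\<close>

lemma pv_identity_iff: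
  assumes "uh \<in> W2 M \<Omega> \<Phi>" "v \<in> W2 M \<Omega> \<Phi>"
  shows "pv_identity M \<phi> uh g v \<longleftrightarrow>
    integral\<^sup>L (M \<Otimes>\<^sub>M M) (flux uh v) = 2 * (LINT x|M. g x * v x)"
proof -
  have eq: "(\<lambda>(x, y). \<phi> x y (uh x - uh y) * (v x - v y)) = flux uh v"
    by (auto simp: flux_def)
  have "(LINT x|M. (LINT y|M. \<phi> x y (uh x - uh y) * (v x - v y)))
      = integral\<^sup>L (M \<Otimes>\<^sub>M M) (flux uh v)"
    using pair.integral_fst'[OF flux_integrable[OF assms]] by (simp add: flux_def)
  then show ?thesis
    unfolding pv_identity_def eq using flux_integrable[OF assms] by auto
qed

text \<open>Two right-hand sides have the same pairing with each test function, so their difference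
  lies in the associate space and is annihilated by \<open>D\<close>. This makes the choice in
  \<open>principal_value\<close> harmless.\<close>

lemma weak_solution_unique:
  assumes "D \<subseteq> W2 M \<Omega> \<Phi>" "separates_points_of_associate M D" "uh \<in> W2 M \<Omega> \<Phi>"
    and g: "weak_solution M \<phi> D g uh" and g': "weak_solution M \<phi> D g' uh"
  shows "AE x in M. g x = g' x"
proof -
  have meas: "g \<in> borel_measurable M" "g' \<in> borel_measurable M"
    and int: "\<And>v. v \<in> D \<Longrightarrow> integrable M (\<lambda>x. g x * v x)"
      "\<And>v. v \<in> D \<Longrightarrow> integrable M (\<lambda>x. g' x * v x)"
    using g g' by (auto simp: weak_solution_def associate_space_def)
  have assoc: "(\<lambda>x. g x - g' x) \<in> associate_space M D"
    using meas int by (auto simp: associate_space_def left_diff_distrib)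
  have "(LINT x|M. (g x - g' x) * v x) = 0" if v: "v \<in> D" for v
  proof -
    have "v \<in> W2 M \<Omega> \<Phi>" using v assms by blast
    then have "(LINT x|M. g x * v x) = (LINT x|M. g' x * v x)"
      using g g' v assms(3) pv_identity_iff[of uh v g] pv_identity_iff[of uh v g']
      by (simp add: weak_solution_def)
    then show ?thesis
      using int[OF v] by (simp add: left_diff_distrib)
  qed
  with bspec[OF assms(2)[unfolded separates_points_of_associate_def] assoc]
  have "AE x in M. g x - g' x = 0" by blast
  then show ?thesis by simp
qed

text \<open>The chosen principal value equals \<open>f\<close> continued by \<open>0\<close> almost
  everywhere, since both are weak right-hand sides. The last clause of \<open>pv_solution\<close> is
  therefore the variational equation of \<open>elliptic_extension_iff\<close>.\<close>

lemma pv_solution_iff: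
  assumes "u \<in> L2 (restrict_space M \<Omega>)" and f: "f \<in> L2 (restrict_space M \<Omega>)"
    and D: "D \<subseteq> W2 M \<Omega> \<Phi>" "separates_points_of_associate M D"
  shows "pv_solution M \<Omega> \<Phi> \<phi> D u f uh \<longleftrightarrow> elliptic_extension M \<Omega> \<Phi> u f uh"
proof -
  define g where "g = (\<lambda>x. if x \<in> \<Omega> then f x else 0)"
  define pv where "pv = principal_value M \<phi> D uh"
  have swap: "(LINT x|M. pv x * v x) = (LINT x|M. g x * v x)"
    if uh: "uh \<in> W2 M \<Omega> \<Phi>" and ws: "weak_solution M \<phi> D g uh" and v: "v \<in> W2 M \<Omega> \<Phi>" for v
  proof -
    \<comment> \<open>The hypothesis \<open>ws\<close> provides a witness, so the choice operator
      does return a weak right-hand side.\<close>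
    have pv: "weak_solution M \<phi> D pv uh"
      unfolding pv_def principal_value_def using ws by (rule someI[where P = "\<lambda>g. weak_solution M \<phi> D g uh"])
    then have "pv \<in> borel_measurable M" "g \<in> borel_measurable M"
      using ws by (auto simp: weak_solution_def associate_space_def)
    moreover have "AE x in M. pv x * v x = g x * v x"
      using weak_solution_unique[OF D uh pv ws] by eventually_elim simp
    ultimately show ?thesis
      using W2_measurable[OF v] by (intro integral_cong_AE) auto
  qed
  show ?thesis
  proof
    assume "pv_solution M \<Omega> \<Phi> \<phi> D u f uh"
    then have uh: "uh \<in> W2 M \<Omega> \<Phi>" "restricts_to M \<Omega> uh u"
      and ws: "weak_solution M \<phi> D g uh"
      and pv: "\<And>v. v \<in> W2 M \<Omega> \<Phi> \<Longrightarrow> pv_identity M \<phi> uh pv v"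
      by (auto simp: pv_solution_def g_def pv_def)
    have "integral\<^sup>L (M \<Otimes>\<^sub>M M) (flux uh v) = 2 * (LINT x:\<Omega>|M. f x * v x)"
      if v: "v \<in> W2 M \<Omega> \<Phi>" for v
      using pv[OF v] swap[OF uh(1) ws v]
      by (simp add: pv_identity_iff[OF uh(1) v] set_integral_extend_zero g_def)
    with uh show "elliptic_extension M \<Omega> \<Phi> u f uh"
      using assms by (simp add: elliptic_extension_iff)
  next
    assume "elliptic_extension M \<Omega> \<Phi> u f uh"
    then have uh: "uh \<in> W2 M \<Omega> \<Phi>" "restricts_to M \<Omega> uh u"
      and eq: "\<And>v. v \<in> W2 M \<Omega> \<Phi> \<Longrightarrow>
        integral\<^sup>L (M \<Otimes>\<^sub>M M) (flux uh v) = 2 * (LINT x|M. g x * v x)"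
      using assms by (auto simp: elliptic_extension_iff set_integral_extend_zero g_def)
    \<comment> \<open>Testing with \<open>D\<close> alone already yields a weak solution; only then
      does \<open>swap\<close> apply to all of \<open>W2\<close>.\<close>
    have ws: "weak_solution M \<phi> D g uh"
      using D(1) eq extend_zero_associate[OF f D(1)] uh(1)
      by (auto simp: weak_solution_def g_def pv_identity_iff subset_iff)
    have "pv_identity M \<phi> uh pv v" if v: "v \<in> W2 M \<Omega> \<Phi>" for v
      using eq[OF v] swap[OF uh(1) ws v] by (simp add: pv_identity_iff[OF uh(1) v])
    with uh ws show "pv_solution M \<Omega> \<Phi> \<phi> D u f uh"
      by (simp add: pv_solution_def g_def pv_def)
  qed
qed

section \<open>Minimality of elliptic extensions\<close>

text \<open>The linear term sees only values on \<open>\<Omega>\<close>, where both functions agree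
  with \<open>u\<close>; it is thus constant on the functions restricting to
  \<open>u\<close>.\<close>

lemma set_integral_restricts_to:
  assumes f: "f \<in> L2 (restrict_space M \<Omega>)" and w: "w \<in> W2 M \<Omega> \<Phi>" "w' \<in> W2 M \<Omega> \<Phi>"
    and restr: "restricts_to M \<Omega> w u" "restricts_to M \<Omega> w' u"
  shows "(LINT x:\<Omega>|M. f x * w x) = (LINT x:\<Omega>|M. f x * w' x)"
proof -
  have "AE x in M. x \<in> \<Omega> \<longrightarrow> w x = u x" "AE x in M. x \<in> \<Omega> \<longrightarrow> w' x = u x"
    using restr by (auto simp: restricts_to_def AE_restrict_space_iff)
  then have "AE x in M. (if x \<in> \<Omega> then f x else 0) * w x = (if x \<in> \<Omega> then f x else 0) * w' x"
    by eventually_elim auto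
  then show ?thesis
    unfolding set_integral_extend_zero
    by (rule integral_cong_AE[rotated 2])
      (intro borel_measurable_integrable extend_zero_integrable f w)+
qed

text \<open>The subgradient inequality is tested with \<open>w - uh\<close>, which vanishes almost
  everywhere on \<open>\<Omega>\<close>, so its pairing with \<open>f\<close> is
  \<open>0\<close>.\<close>

lemma elliptic_extension_minimal:
  assumes ell: "elliptic_extension M \<Omega> \<Phi> u f uh"
    and w: "w \<in> W2 M \<Omega> \<Phi>" "restricts_to M \<Omega> w u"
  shows "energy M \<Phi> uh \<le> energy M \<Phi> w"
proof -
  have uh: "uh \<in> W2 M \<Omega> \<Phi>" "restricts_to M \<Omega> uh u" and f: "f \<in> L2 (restrict_space M \<Omega>)"
    using ell by (auto simp: elliptic_extension_def)
  have d: "(\<lambda>x. w x - uh x) \<in> W2 M \<Omega> \<Phi>"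
    by (rule W2_diff) fact+
  have "(LINT x:\<Omega>|M. f x * (w x - uh x)) = (LINT x:\<Omega>|M. f x * w x) - (LINT x:\<Omega>|M. f x * uh x)"
    unfolding set_integral_extend_zero
    using extend_zero_integrable[OF f] w(1) uh(1) by (simp add: right_diff_distrib)
  also have "\<dots> = 0"
    using set_integral_restricts_to[OF f w(1) uh(1) w(2) uh(2)] by simp
  finally have "0 \<le> enn2ereal (energy M \<Phi> (\<lambda>x. uh x + (w x - uh x))) - enn2ereal (energy M \<Phi> uh)"
    using ell d unfolding elliptic_extension_def by (metis zero_ereal_def)
  then show ?thesis
    by (simp add: enn2ereal_energy w(1) uh(1)) (simp add: energy_eq w(1) uh(1) ennreal_leI)
qed

text \<open>On the constraint set the two functionals differ by a real constant and all energies are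
  finite, so strict comparisons agree.\<close>

lemma is_arg_min_energy_iff:
  assumes f: "f \<in> L2 (restrict_space M \<Omega>)"
  shows "is_arg_min (\<lambda>w. enn2ereal (energy M \<Phi> w) - ereal (LINT x:\<Omega>|M. f x * w x))
      (\<lambda>w. w \<in> W2 M \<Omega> \<Phi> \<and> restricts_to M \<Omega> w u) w
    \<longleftrightarrow> is_arg_min (energy M \<Phi>) (\<lambda>w. w \<in> W2 M \<Omega> \<Phi> \<and> restricts_to M \<Omega> w u) w"
proof -
  have "enn2ereal (energy M \<Phi> w') - ereal (LINT x:\<Omega>|M. f x * w' x)
      < enn2ereal (energy M \<Phi> w) - ereal (LINT x:\<Omega>|M. f x * w x)
    \<longleftrightarrow> energy M \<Phi> w' < energy M \<Phi> w"
    if "w' \<in> W2 M \<Omega> \<Phi> \<and> restricts_to M \<Omega> w' u" "w \<in> W2 M \<Omega> \<Phi> \<and> restricts_to M \<Omega> w u" for w w'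
  proof -
    have "energy M \<Phi> w' < energy M \<Phi> w \<longleftrightarrow> enn2ereal (energy M \<Phi> w') < enn2ereal (energy M \<Phi> w)"
      by (simp add: less_ennreal.rep_eq)
    moreover have "(LINT x:\<Omega>|M. f x * w' x) = (LINT x:\<Omega>|M. f x * w x)"
      using set_integral_restricts_to[OF f] that by blast
    ultimately show ?thesis
      using that by (simp add: enn2ereal_energy)
  qed
  then show ?thesis
    unfolding is_arg_min_def by blast
qed

lemma elliptic_extension_is_arg_min:
  assumes "elliptic_extension M \<Omega> \<Phi> u f uh"
  shows "is_arg_min (energy M \<Phi>) (\<lambda>w. w \<in> W2 M \<Omega> \<Phi> \<and> restricts_to M \<Omega> w u) uh"
proof -
  have "uh \<in> W2 M \<Omega> \<Phi>" "restricts_to M \<Omega> uh u"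
    using assms by (auto simp: elliptic_extension_def)
  then show ?thesis
    unfolding is_arg_min_def using elliptic_extension_minimal[OF assms] by (meson not_less)
qed

section \<open>Uniqueness under strict convexity\<close>

text \<open>The midpoint \<open>w\<close> of two minimizers is admissible, so the convexity
  inequality for the energy is an equality there. Its integrand must then be an equality almost
  everywhere, which strict convexity permits only for equal increments.\<close>

lemma minimizers_equal_increments:
  assumes strict: "\<forall>(x, y) \<in> S_set M \<Phi>. strictly_convex_fun (\<Phi> x y)"
    and u1: "is_arg_min (energy M \<Phi>) (\<lambda>w. w \<in> W2 M \<Omega> \<Phi> \<and> restricts_to M \<Omega> w u) u1"
    and u2: "is_arg_min (energy M \<Phi>) (\<lambda>w. w \<in> W2 M \<Omega> \<Phi> \<and> restricts_to M \<Omega> w u) u2"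
  shows "AE p in M \<Otimes>\<^sub>M M. p \<in> S_set M \<Phi> \<longrightarrow> u1 (fst p) - u1 (snd p) = u2 (fst p) - u2 (snd p)"
proof -
  have W: "u1 \<in> W2 M \<Omega> \<Phi>" "u2 \<in> W2 M \<Omega> \<Phi>"
    and R: "restricts_to M \<Omega> u1 u" "restricts_to M \<Omega> u2 u"
    using u1 u2 by (auto simp: is_arg_min_def)
  define w where "w = (\<lambda>x. (1 / 2) * u1 x + (1 / 2) * u2 x)"
  have w: "w \<in> W2 M \<Omega> \<Phi>"
    unfolding w_def by (intro W2_add W2_scale W)
  have "restricts_to M \<Omega> w u"
    using R unfolding restricts_to_def by eventually_elim (simp add: w_def)
  with w u1 u2 have le: "energy M \<Phi> u1 \<le> energy M \<Phi> w" "energy M \<Phi> u2 \<le> energy M \<Phi> w"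
    by (auto simp: is_arg_min_def not_less)
  have nonneg: "0 \<le> integral\<^sup>L (M \<Otimes>\<^sub>M M) (energy_density v)" for v
    by (rule integral_nonneg_AE) (auto intro: AE_I2 energy_density_nonneg)
  define gap where "gap p = (1 / 2) * energy_density u1 p + (1 / 2) * energy_density u2 p
    - energy_density w p" for p
  note int = W[THEN W2_energy_density_integrable] W2_energy_density_integrable[OF w]
  have gap_nonneg: "0 \<le> gap p" if "p \<in> space (M \<Otimes>\<^sub>M M)" for p
    using that primitive_convex[of "fst p" "snd p" "1 / 2" "u1 (fst p) - u1 (snd p)"
        "u2 (fst p) - u2 (snd p)"]
    by (auto simp: gap_def energy_density_def w_def space_pair_measure field_simps)
  have gap_int: "integrable (M \<Otimes>\<^sub>M M) gap"
    unfolding gap_def[abs_def] using int by simp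
  \<comment> \<open>Both minimal energies are at most the energy of \<open>w\<close>, hence so is
    their mean.\<close>
  have "integral\<^sup>L (M \<Otimes>\<^sub>M M) gap \<le> 0"
    unfolding gap_def[abs_def] using int le nonneg[of w]
    by (simp add: energy_eq W w ennreal_le_iff)
  moreover have "0 \<le> integral\<^sup>L (M \<Otimes>\<^sub>M M) gap"
    by (rule integral_nonneg_AE) (auto intro: AE_I2 gap_nonneg)
  ultimately have "AE p in M \<Otimes>\<^sub>M M. gap p = 0"
    using integral_nonneg_eq_0_iff_AE[OF gap_int] gap_nonneg by (auto intro: AE_I2)
  then show ?thesis
  proof eventually_elim
    fix p assume gap0: "gap p = 0"
    show "p \<in> S_set M \<Phi> \<longrightarrow> u1 (fst p) - u1 (snd p) = u2 (fst p) - u2 (snd p)"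
    proof (rule impI, rule ccontr)
      assume p: "p \<in> S_set M \<Phi>" and ne: "u1 (fst p) - u1 (snd p) \<noteq> u2 (fst p) - u2 (snd p)"
      obtain x y where xy: "p = (x, y)" "x \<in> space M" "y \<in> space M"
        using p by (auto simp: S_set_def)
      have psp: "p \<in> space (M \<Otimes>\<^sub>M M)"
        using xy by (simp add: space_pair_measure)
      have "strictly_convex_fun (\<Phi> x y)"
        using strict p xy by auto
      then have "\<Phi> x y ((1 - 1 / 2) * (u1 x - u1 y) + (1 / 2) * (u2 x - u2 y))
          < ennreal (1 - 1 / 2) * \<Phi> x y (u1 x - u1 y) + ennreal (1 / 2) * \<Phi> x y (u2 x - u2 y)"
        using ne xy unfolding strictly_convex_fun_def
        by (elim allE[of _ "u1 x - u1 y"] allE[of _ "u2 x - u2 y"] allE[of _ "1 / 2 :: real"]) simp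
      also have "(1 - 1 / 2) * (u1 x - u1 y) + (1 / 2) * (u2 x - u2 y) = w x - w y"
        by (simp add: w_def field_simps)
      also have "ennreal (1 - 1 / 2) * \<Phi> x y (u1 x - u1 y) + ennreal (1 / 2) * \<Phi> x y (u2 x - u2 y)
          = ennreal ((1 / 2) * energy_density u1 p + (1 / 2) * energy_density u2 p)"
        using xy energy_density_nonneg[OF psp, of u1] energy_density_nonneg[OF psp, of u2]
        by (simp add: Phi_energy_density del: ennreal_half ennreal_plus
            flip: ennreal_mult ennreal_plus)
      finally have "energy_density w p < (1 / 2) * energy_density u1 p + (1 / 2) * energy_density u2 p"
        using xy energy_density_nonneg[OF psp, of w] by (simp add: Phi_energy_density ennreal_less_iff)
      with gap0 show False by (simp add: gap_def)
    qed
  qed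
qed

text \<open>Induction on the stage \<open>m\<close>: once \<open>d\<close> vanishes almost
  everywhere on a set \<open>A m n\<close> of positive measure, that set contains a point
  \<open>x\<close> with \<open>d x = 0\<close> whose section of \<open>S\<close> carries the same
  value almost everywhere. This section contains \<open>B (Suc m) n\<close>.\<close>

lemma thick_propagates_zero:
  fixes d :: "'a \<Rightarrow> real"
  assumes thick: "thick M \<Omega> S"
    and zero: "AE x in M. x \<in> \<Omega> \<longrightarrow> d x = 0"
    and const: "AE x in M. AE y in M. (x, y) \<in> S \<longrightarrow> d x = d y"
  shows "AE x in M. d x = 0"
proof -
  obtain A B :: "nat \<Rightarrow> nat \<Rightarrow> 'a set" and I :: "nat \<Rightarrow> nat set" and N where
    A: "\<And>m n. A m n \<in> sets M" and A0: "\<And>n. A 0 n \<subseteq> \<Omega>" and N: "N \<in> null_sets M"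
    and I: "\<And>m. I m = {n. emeasure M (A m n) > 0}"
    and B: "\<And>m n. A m n \<times> B (Suc m) n \<subseteq> S"
    and AB: "\<And>m. (\<Union>n. A (Suc m) n) = (\<Union>n\<in>I m. B (Suc m) n)"
    and cover: "space M - N = (\<Union>m. \<Union>n\<in>I m. A m n)"
    using thick unfolding thick_def by (elim exE conjE) (rule that, auto)
  have *: "AE x in M. \<forall>n. x \<in> A m n \<longrightarrow> d x = 0" for m
  proof (induction m)
    case 0
    show ?case using zero by eventually_elim (use A0 in blast)
  next
    case (Suc m)
    have "AE y in M. y \<in> B (Suc m) n \<longrightarrow> d y = 0" if n: "n \<in> I m" for n
    proof -
      have "\<not> (AE x in M. x \<notin> A m n)"
        using n A[of m n] by (simp add: I AE_iff_null_sets[symmetric] null_sets_def)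
      \<comment> \<open>Without such a point, the two almost-everywhere properties would make
        \<open>A m n\<close> a null set, contrary to \<open>n \<in> I m\<close>.\<close>
      moreover have "AE x in M. x \<notin> A m n"
        if "\<nexists>x. x \<in> A m n \<and> (AE y in M. (x, y) \<in> S \<longrightarrow> d x = d y) \<and> d x = 0"
        using const Suc by eventually_elim (use that in blast)
      ultimately obtain x where x: "x \<in> A m n" "d x = 0"
        and "AE y in M. (x, y) \<in> S \<longrightarrow> d x = d y"
        by blast
      from this(3) show ?thesis
        by eventually_elim (use B[of m n] x in auto)
    qed
    \<comment> \<open>Countably many null sets are united; by \<open>AB\<close>, the sets
      \<open>B (Suc m) n\<close> with \<open>n \<in> I m\<close> cover every
      \<open>A (Suc m) n\<close>.\<close>
    then have "AE y in M. \<forall>n\<in>I m. y \<in> B (Suc m) n \<longrightarrow> d y = 0"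
      by (subst AE_ball_countable) auto
    then show ?case
      by eventually_elim (use AB[of m] in blast)
  qed
  have "AE x in M. \<forall>m n. x \<in> A m n \<longrightarrow> d x = 0"
    using * by (subst AE_all_countable) blast
  moreover have "AE x in M. x \<notin> N"
    using N by (rule AE_not_in)
  ultimately show ?thesis
    using AE_space by eventually_elim (use cover in blast)
qed

text \<open>The right-hand sides \<open>f1\<close> and \<open>f2\<close> may differ, because both
  extensions minimize the same energy under the same constraint. Their difference is
  \<open>0\<close> on \<open>\<Omega>\<close> and has equal values at almost all pairs in
  \<open>S_set M \<Phi>\<close>.\<close>

lemma elliptic_extension_unique:
  assumes thick: "thick M \<Omega> (S_set M \<Phi>)"
    and strict: "\<forall>(x, y) \<in> S_set M \<Phi>. strictly_convex_fun (\<Phi> x y)"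
    and ell: "elliptic_extension M \<Omega> \<Phi> u f1 u1" "elliptic_extension M \<Omega> \<Phi> u f2 u2"
  shows "AE x in M. u1 x = u2 x"
proof -
  have "AE p in M \<Otimes>\<^sub>M M. p \<in> S_set M \<Phi> \<longrightarrow> u1 (fst p) - u1 (snd p) = u2 (fst p) - u2 (snd p)"
    by (rule minimizers_equal_increments[OF strict]) (rule elliptic_extension_is_arg_min, fact)+
  from pair.AE_pair[OF this]
  have const: "AE x in M. AE y in M. (x, y) \<in> S_set M \<Phi> \<longrightarrow> u1 x - u2 x = u1 y - u2 y"
    by (simp add: algebra_simps)
  have "AE x in M. x \<in> \<Omega> \<longrightarrow> u1 x = u x" "AE x in M. x \<in> \<Omega> \<longrightarrow> u2 x = u x"
    using ell by (auto simp: elliptic_extension_def restricts_to_def AE_restrict_space_iff)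
  then have zero: "AE x in M. x \<in> \<Omega> \<longrightarrow> u1 x - u2 x = 0"
    by eventually_elim auto
  from thick_propagates_zero[OF thick zero const] show ?thesis by simp
qed

end

theorem theorem3p5:
  fixes M :: "'a measure"
    and \<Omega> :: "'a set"
    and \<Phi> :: "'a \<Rightarrow> 'a \<Rightarrow> real \<Rightarrow> ennreal"
    and \<phi> :: "'a \<Rightarrow> 'a \<Rightarrow> real \<Rightarrow> real"
    and D :: "('a \<Rightarrow> real) set"
    and u f :: "'a \<Rightarrow> real"
  assumes "sigma_finite_measure M"
    and "\<Omega> \<in> sets M"
    and "standard_conditions M \<Omega> \<Phi>"
    and "condition_D M \<Phi> \<phi>"
    and "u \<in> L2 (restrict_space M \<Omega>)"
    and "f \<in> L2 (restrict_space M \<Omega>)"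
    and "linear_subspace D"
    and "D \<subseteq> W2 M \<Omega> \<Phi>"
    and "separates_points_of_associate M D"
  shows "((u, f) \<in> j_subgradient M \<Omega> \<Phi> \<longleftrightarrow> (\<exists>uh. pv_solution M \<Omega> \<Phi> \<phi> D u f uh))
    \<and> (\<forall>uh. pv_solution M \<Omega> \<Phi> \<phi> D u f uh \<longrightarrow>
         elliptic_extension M \<Omega> \<Phi> u f uh
         \<and> uh \<in> {w. is_arg_min
                 (\<lambda>w. enn2ereal (energy M \<Phi> w) - ereal (LINT x:\<Omega>|M. f x * w x))
                 (\<lambda>w. w \<in> W2 M \<Omega> \<Phi> \<and> restricts_to M \<Omega> w u) w}
         \<and> {w. is_arg_min
                 (\<lambda>w. enn2ereal (energy M \<Phi> w) - ereal (LINT x:\<Omega>|M. f x * w x))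
                 (\<lambda>w. w \<in> W2 M \<Omega> \<Phi> \<and> restricts_to M \<Omega> w u) w}
           = {w. is_arg_min (energy M \<Phi>)
                 (\<lambda>w. w \<in> W2 M \<Omega> \<Phi> \<and> restricts_to M \<Omega> w u) w})
    \<and> ((\<forall>(x, y) \<in> S_set M \<Phi>. strictly_convex_fun (\<Phi> x y)) \<longrightarrow>
         (\<forall>f1 f2 uh1 uh2. elliptic_extension M \<Omega> \<Phi> u f1 uh1 \<longrightarrow>
            elliptic_extension M \<Omega> \<Phi> u f2 uh2 \<longrightarrow> (AE x in M. uh1 x = uh2 x)))"
proof -
  interpret nonlocal_energy M \<Omega> \<Phi> \<phi>
    using assms by (auto simp: nonlocal_energy_def nonlocal_energy_axioms_def standard_conditions_def)
  have thick: "thick M \<Omega> (S_set M \<Phi>)"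
    using assms by (simp add: standard_conditions_def)
  have iff: "pv_solution M \<Omega> \<Phi> \<phi> D u f uh \<longleftrightarrow> elliptic_extension M \<Omega> \<Phi> u f uh" for uh
    using assms by (intro pv_solution_iff)
  have arg_min: "{w. is_arg_min
        (\<lambda>w. enn2ereal (energy M \<Phi> w) - ereal (LINT x:\<Omega>|M. f x * w x))
        (\<lambda>w. w \<in> W2 M \<Omega> \<Phi> \<and> restricts_to M \<Omega> w u) w}
      = {w. is_arg_min (energy M \<Phi>) (\<lambda>w. w \<in> W2 M \<Omega> \<Phi> \<and> restricts_to M \<Omega> w u) w}"
    using assms by (simp only: is_arg_min_energy_iff)
  show ?thesis
    \<comment> \<open>Only claims about elliptic extensions and minimizers of the energy remain; the
      equality of the two sets of minimizers has become reflexive.\<close>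
    unfolding arg_min iff
  proof (intro conjI allI impI refl)
    show "(u, f) \<in> j_subgradient M \<Omega> \<Phi> \<longleftrightarrow> (\<exists>uh. elliptic_extension M \<Omega> \<Phi> u f uh)"
      by (simp add: j_subgradient_def)
  next
    fix uh assume "elliptic_extension M \<Omega> \<Phi> u f uh"
    then show "uh \<in> {w. is_arg_min (energy M \<Phi>)
        (\<lambda>w. w \<in> W2 M \<Omega> \<Phi> \<and> restricts_to M \<Omega> w u) w}"
      using elliptic_extension_is_arg_min by blast
  next
    fix f1 f2 uh1 uh2
    assume "\<forall>(x, y)\<in>S_set M \<Phi>. strictly_convex_fun (\<Phi> x y)"
      "elliptic_extension M \<Omega> \<Phi> u f1 uh1" "elliptic_extension M \<Omega> \<Phi> u f2 uh2"
    then show "AE x in M. uh1 x = uh2 x"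
      by (rule elliptic_extension_unique[OF thick])
  qed
qed

end
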